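(* Let $d \geq 2$ be an integer and let $p \in [1,d)$. Let $H$ be a norm on $\mathbb{R}^d$ and let $\mathring{H}$ be the associated dual norm. Then, for all $f \in \mathcal{C}_c^{\infty}(\mathbb{R}^d)$, $$\left(\int_{\mathbb{R}^d} H\left(\nabla(f)(x)\right)^p dx\right)^{\frac{1}{p}} \geq \left(\frac{d-p}{p}\right) \mathcal{L}_d(B_{\mathring{H}})^{\frac{1}{d}}\, \|f\|_{p^*,p},$$ where $p^*=pd/(d-p)$, $\|\cdot\|_{p^*,p}$ is the Lorentz quasi-norm $(p^*,p)$ and $B_{\mathring{H}}$ is the unit ball with respect to the dual norm $\mathring{H}$.
   Context: $\mathcal{L}_d$ is $d$-dimensional Lebesgue measure. The dual norm is $\mathring{H}(x)=\sup_{y\in\mathbb{R}^d,\,H(y)\leq1}|\langle x;y\rangle|$ with $\langle\cdot;\cdot\rangle$ the Euclidean inner product, and $B_{\mathring{H}}=\{x\in\mathbb{R}^d:\mathring{H}(x)\leq1\}$. The Lorentz quasi-norm is normalized by $$\|f\|_{p^*,p}^p=p^*\int_0^{+\infty}\mathcal{L}_d\left(\{x\in\mathbb{R}^d:|f(x)|>t\}\right)^{\frac{p}{p^*}}t^{p-1}dt.$$ *)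

theory Defs
  imports "HOL-Analysis.Analysis"
begin

definition is_norm :: "('a::real_vector \<Rightarrow> real) \<Rightarrow> bool" where
  "is_norm H \<longleftrightarrow>
     (\<forall>x. 0 \<le> H x) \<and>
     (\<forall>x. H x = 0 \<longleftrightarrow> x = 0) \<and>
     (\<forall>c x. H (c *\<^sub>R x) = \<bar>c\<bar> * H x) \<and>
     (\<forall>x y. H (x + y) \<le> H x + H y)"

text \<open>On a Euclidean space the supremum below is finite whenever \<open>H\<close> is a norm, so the
  real-valued \<open>SUP\<close> is the intended one.\<close>

definition dual_norm :: "('a::euclidean_space \<Rightarrow> real) \<Rightarrow> 'a \<Rightarrow> real" where
  "dual_norm H x = (SUP y\<in>{y. H y \<le> 1}. \<bar>x \<bullet> y\<bar>)"

text \<open>\<open>C\<^sup>k\<close> regularity on the whole space: the function is differentiable and all its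
  directional derivatives are of class \<open>C\<^bsup>k-1\<^esup>\<close>.\<close>

primrec Ck :: "nat \<Rightarrow> ('a::euclidean_space \<Rightarrow> real) \<Rightarrow> bool" where
  "Ck 0 f \<longleftrightarrow> continuous_on UNIV f"
| "Ck (Suc k) f \<longleftrightarrow>
     (\<forall>x. f differentiable (at x)) \<and> (\<forall>v. Ck k (\<lambda>x. frechet_derivative f (at x) v))"

definition test_function :: "('a::euclidean_space \<Rightarrow> real) \<Rightarrow> bool" where
  "test_function f \<longleftrightarrow> (\<forall>k. Ck k f) \<and> compact (closure (support_on UNIV f))"

definition gradient :: "('a::euclidean_space \<Rightarrow> real) \<Rightarrow> 'a \<Rightarrow> 'a" where
  "gradient f x = (THE D. GDERIV f x :> D)"

text \<open>Real powers on \<open>[0, \<infinity>]\<close>, used only for exponents \<open>a > 0\<close>, for which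
  \<open>\<infinity>\<close> to the power \<open>a\<close> is \<open>\<infinity>\<close> and \<open>0\<close> to the power \<open>a\<close> is \<open>0\<close>.\<close>

definition epowr :: "ennreal \<Rightarrow> real \<Rightarrow> ennreal" (infixr \<open>epowr\<close> 80) where
  "x epowr a = (if x = top then top else ennreal (enn2real x powr a))"

text \<open>The Lorentz \<open>(q, r)\<close> quasi-norm with values in \<open>[0, \<infinity>]\<close>, for \<open>0 < q, r < \<infinity>\<close>.\<close>

definition lorentz_norm :: "real \<Rightarrow> real \<Rightarrow> ('a::euclidean_space \<Rightarrow> real) \<Rightarrow> ennreal" where
  "lorentz_norm q r f =
     (ennreal q * (\<integral>\<^sup>+t\<in>{0<..}.
        (emeasure lebesgue {x. \<bar>f x\<bar> > t} epowr (r / q)) * ennreal (t powr (r - 1)) \<partial>lborel))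
     epowr (1 / r)"

end

theory Submission
  imports Defs
begin

text \<open>
  The Brunn--Minkowski inequality replaces rearrangement and the coarea formula.  With \<open>B\<close> the unit
  ball of the dual norm and \<open>F = \<bar>f\<bar>\<close>, the values of \<open>F\<close> on \<open>x + \<epsilon> B\<close> are at least
  \<open>F x - \<epsilon> (H (\<nabla>f x) + \<eta>)\<close> for small \<open>\<epsilon>\<close>, so a superlevel set of the latter function,
  enlarged by \<open>\<epsilon> B\<close>, stays in the superlevel set of \<open>F\<close>.  Integrating the resulting volume inequality
  against an increasing weight \<open>\<psi>\<close> on the levels and letting \<open>\<epsilon> \<rightarrow> 0\<close> yields
  \<open>\<integral> \<psi>(F) H(\<nabla>f) dx \<ge> d |B|\<^bsup>1/d\<^esup> \<integral> \<psi>(t) m(t)\<^bsup>1-1/d\<^esup> dt\<close> with \<open>m(t) = |{F \<ge> t}|\<close>.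
  For \<open>\<psi>(t) = (t m(t)\<^bsup>-1/d\<^esup>)\<^bsup>p-1\<^esup>\<close>, Young's inequality on the left-hand side is sharp
  for the extremal profile, and the remaining term \<open>\<integral> F\<^bsup>p\<^esup> m(F)\<^bsup>-p/d\<^esup> dx\<close> is
  at most \<open>p\<^sup>*\<close> times the Lorentz integral.
\<close>

section \<open>Brunn--Minkowski inequality\<close>

text \<open>The constants come from the profile F = N^(-s), where N is the dual norm and s =
  (d-p)/p. For it m(t)^(1/d) = |B|^(1/d) t^(-1/s), and H(\<nabla>F) = s t^(1+1/s) where F = t. So
  H(\<nabla>F) = \<kappa> u with u = t m(t)^(-1/d) and \<kappa> = s |B|^(1/d). Young's inequality is
  therefore applied to u^(p-1) and H(\<nabla>f)/\<kappa>, which makes it an equality for this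
  profile and forces \<psi> = u^(p-1). The same weight produces the Lorentz integrand, since
  \<psi>(t) m(t)^(1-1/d) = t^(p-1) m(t)^(1-p/d) and 1 - p/d = p/p*. Write J for the integral of the
  latter and G for that of H(\<nabla>f)^p. As d |B|^(1/d) = \<kappa> p*, the estimates combine to
  \<kappa> p* J \<le> \<kappa>^(1-p) G / p + \<kappa> (1 - 1/p) p* J, and absorption leaves
  \<kappa>^p p* J \<le> G. Two obstacles shape the details: m may tend to 0 at the top of the range
  of F, where the negative power in \<psi> is out of control, and level sets of F may have positive
  volume, so that the distribution of m(F) can only be estimated from one side.\<close>

definition box_family :: "'a::euclidean_space set set \<Rightarrow> bool" where
  "box_family D \<longleftrightarrow> finite D \<and> (\<forall>K\<in>D. K \<noteq> {} \<and> (\<exists>a b. K = box a b)) \<and> disjoint D"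

section \<open>Families of disjoint boxes and coordinate half-spaces\<close>

lemma box_Int_halfspace_less:
  fixes a b :: "'a::euclidean_space"
  assumes "i \<in> Basis"
  shows "\<exists>a' b'. box a b \<inter> {x. x \<bullet> i < c} = box a' b'"
proof -
  have "box a b \<inter> {x. x \<bullet> i < c} = box a (\<Sum>j\<in>Basis. (if j = i then min (b \<bullet> i) c else b \<bullet> j) *\<^sub>R j)"
    using assms by (auto simp: mem_box set_eq_iff split: if_splits)
  then show ?thesis by blast
qed

lemma box_Int_halfspace_greater:
  fixes a b :: "'a::euclidean_space"
  assumes "i \<in> Basis"
  shows "\<exists>a' b'. box a b \<inter> {x. c < x \<bullet> i} = box a' b'"
proof -
  have "box a b \<inter> {x. c < x \<bullet> i} = box (\<Sum>j\<in>Basis. (if j = i then max (a \<bullet> i) c else a \<bullet> j) *\<^sub>R j) b"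
    using assms by (auto simp: mem_box set_eq_iff split: if_splits)
  then show ?thesis by blast
qed

text \<open>Empty traces are discarded. This keeps all members nonempty and makes the number of
  boxes drop as soon as one box misses \<open>S\<close>; the strict drop drives the later
  induction.\<close>

lemma box_family_Int:
  fixes D :: "'a::euclidean_space set set"
  assumes D: "box_family D" and S: "\<And>a b. \<exists>a' b'. box a b \<inter> S = box a' b'"
  obtains D' where "box_family D'" "\<Union>D' = \<Union>D \<inter> S" "card D' \<le> card D"
    "(\<exists>K\<in>D. K \<inter> S = {}) \<longrightarrow> card D' < card D"
proof
  define D' where "D' = (\<lambda>K. K \<inter> S) ` D - {{}}"
  have fin: "finite D" and "disjoint D"
    using D by (auto simp: box_family_def)
  then have "disjoint D'"
    unfolding D'_def disjoint_def by (clarsimp) blast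
  moreover have "\<exists>a b. K = box a b" if "K \<in> D'" for K
  proof -
    obtain L where "L \<in> D" "K = L \<inter> S"
      using \<open>K \<in> D'\<close> by (auto simp: D'_def)
    moreover obtain a b where "L = box a b"
      using D \<open>L \<in> D\<close> unfolding box_family_def by meson
    ultimately show ?thesis using S by metis
  qed
  moreover have "finite D'" "{} \<notin> D'"
    using fin by (auto simp: D'_def)
  ultimately show "box_family D'"
    unfolding box_family_def by metis
  show "\<Union>D' = \<Union>D \<inter> S"
    by (auto simp: D'_def)
  have "card D' \<le> card ((\<lambda>K. K \<inter> S) ` D)"
    unfolding D'_def using fin by (intro card_mono) auto
  also have "\<dots> \<le> card D"
    using fin by (rule card_image_le)
  finally show "card D' \<le> card D" .
  show "(\<exists>K\<in>D. K \<inter> S = {}) \<longrightarrow> card D' < card D"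
  proof (intro impI, elim bexE)
    fix K assume K: "K \<in> D" "K \<inter> S = {}"
    have "D' \<subseteq> (\<lambda>K. K \<inter> S) ` (D - {K})"
      using K by (auto simp: D'_def)
    then have "card D' \<le> card (D - {K})"
      using fin by (meson card_image_le card_mono finite_Diff finite_imageI le_trans)
    also have "\<dots> < card D"
      using fin K by (meson card_Diff1_less)
    finally show "card D' < card D" .
  qed
qed

text \<open>Disjoint nonempty boxes have disjoint projections to some coordinate axis, so the
  hyperplane through a face separates them. Which of the two lies below is unknown, hence the
  renamed \<open>K'\<close> and \<open>L'\<close>.\<close>

lemma box_family_separate:
  fixes D :: "'a::euclidean_space set set"
  assumes "box_family D" "K \<in> D" "L \<in> D" "K \<noteq> L"
  obtains i c K' L' where "i \<in> Basis" "K' \<in> D" "L' \<in> D"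
    "K' \<subseteq> {x. x \<bullet> i < c}" "L' \<subseteq> {x. c < x \<bullet> i}"
proof -
  obtain a b c d where eq: "K = box a b" "L = box c d" and ne: "K \<noteq> {}" "L \<noteq> {}" "K \<inter> L = {}"
    using assms unfolding box_family_def disjoint_def by metis
  obtain i where i: "i \<in> Basis" "b \<bullet> i \<le> c \<bullet> i \<or> d \<bullet> i \<le> a \<bullet> i"
  proof -
    have "\<exists>i\<in>Basis. b \<bullet> i \<le> a \<bullet> i \<or> d \<bullet> i \<le> c \<bullet> i \<or> b \<bullet> i \<le> c \<bullet> i \<or> d \<bullet> i \<le> a \<bullet> i"
      using ne(3) unfolding eq disjoint_interval(4) .
    moreover have "\<not> b \<bullet> i \<le> a \<bullet> i" "\<not> d \<bullet> i \<le> c \<bullet> i" if "i \<in> Basis" for i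
      using ne(1,2) that unfolding eq box_eq_empty by auto
    ultimately show thesis using that by blast
  qed
  then consider "b \<bullet> i \<le> c \<bullet> i" | "d \<bullet> i \<le> a \<bullet> i" by blast
  then show thesis
  proof cases
    case 1
    show thesis
      by (rule that[of i K L "b \<bullet> i"]) (use 1 i assms(2,3) in \<open>auto simp: mem_box eq intro: less_le_trans le_less_trans\<close>)
  next
    case 2
    show thesis
      by (rule that[of i L K "d \<bullet> i"]) (use 2 i assms(2,3) in \<open>auto simp: mem_box eq intro: less_le_trans le_less_trans\<close>)
  qed
qed

section \<open>Volumes cut off by parallel hyperplanes\<close>

lemma bounded_fmeasurable_lborel:
  assumes "bounded A" "A \<in> sets borel"
  shows "A \<in> fmeasurable lborel"
  using emeasure_bounded_finite[OF assms(1)] assms(2) by (intro fmeasurableI) auto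

text \<open>The part of \<open>B\<close> between the two hyperplanes fits into a box of width
  \<open>c' - c\<close> in direction \<open>i\<close> and \<open>2 * r\<close> in every other
  direction. The estimate serves to make the cut-off volume continuous in \<open>c\<close>.\<close>

lemma measure_halfspace_Int_Lipschitz:
  fixes B :: "'a::euclidean_space set"
  assumes "open B" "bounded B" "i \<in> Basis"
  obtains L where "0 \<le> L" "\<And>c c'. c \<le> c' \<Longrightarrow>
    \<bar>measure lborel (B \<inter> {x. x \<bullet> i < c'}) - measure lborel (B \<inter> {x. x \<bullet> i < c})\<bar> \<le> L * (c' - c)"
proof -
  obtain r where r: "\<And>x. x \<in> B \<Longrightarrow> norm x \<le> r" "r > 0"
    using \<open>bounded B\<close> by (auto simp: bounded_pos)
  show thesis
  proof (rule that)
    show "0 \<le> (\<Prod>j\<in>Basis-{i}. 2 * r)" using r by (intro prod_nonneg) auto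
  next
    fix c c' :: real assume "c \<le> c'"
    define lo hi where "lo = (\<Sum>j\<in>Basis. (if j = i then c else - r) *\<^sub>R j)"
      and "hi = (\<Sum>j\<in>Basis. (if j = i then c' else r) *\<^sub>R j)"
    let ?S = "B \<inter> {x. c \<le> x \<bullet> i \<and> x \<bullet> i < c'}"
    have meas: "B \<inter> {x. x \<bullet> i < c} \<in> fmeasurable lborel" for c
      using assms by (intro bounded_fmeasurable_lborel) (auto intro: bounded_subset)
    have eq: "B \<inter> {x. x \<bullet> i < c'} - B \<inter> {x. x \<bullet> i < c} = ?S" by auto
    have sub: "?S \<subseteq> cbox lo hi"
    proof
      fix x assume x: "x \<in> ?S"
      then have "\<bar>x \<bullet> j\<bar> \<le> r" if "j \<in> Basis" for j
        using r(1)[of x] Basis_le_norm[OF that, of x] by auto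
      then show "x \<in> cbox lo hi"
        using x by (auto simp: mem_box lo_def hi_def abs_le_iff) (metis minus_le_iff)
    qed
    have "measure lborel (B \<inter> {x. x \<bullet> i < c'}) - measure lborel (B \<inter> {x. x \<bullet> i < c}) = measure lborel ?S"
      using meas \<open>c \<le> c'\<close> unfolding eq[symmetric]
      by (subst measurable_measure_Diff) (use fmeasurableD[OF meas] in auto)
    also have "\<bar>\<dots>\<bar> \<le> measure lborel (cbox lo hi)"
      using sub unfolding abs_of_nonneg[OF measure_nonneg] by (intro measure_mono_fmeasurable)
       (use fmeasurableD[OF meas] in \<open>auto simp flip: eq intro!: sets.Diff bounded_fmeasurable_lborel\<close>)
    also have "\<dots> = (\<Prod>j\<in>Basis. if j = i then c' - c else 2 * r)"
      using \<open>c \<le> c'\<close> \<open>r > 0\<close> by (auto simp: measure_lborel_cbox_eq lo_def hi_def inner_diff_left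
          intro!: prod.cong)
    also have "\<dots> = (\<Prod>j\<in>Basis-{i}. 2 * r) * (c' - c)"
      using assms by (subst prod.remove[of _ i]) (auto intro!: prod.cong)
    finally show "\<bar>measure lborel (B \<inter> {x. x \<bullet> i < c'}) - measure lborel (B \<inter> {x. x \<bullet> i < c})\<bar>
      \<le> (\<Prod>j\<in>Basis-{i}. 2 * r) * (c' - c)" .
  qed
qed

lemma ex_halfspace_Int_measure_eq:
  fixes B :: "'a::euclidean_space set"
  assumes "open B" "bounded B" "i \<in> Basis" "0 \<le> s" "s \<le> measure lborel B"
  obtains c where "measure lborel (B \<inter> {x. x \<bullet> i < c}) = s"
proof -
  obtain L where L: "0 \<le> L" "\<And>c c'. c \<le> c' \<Longrightarrow>
    \<bar>measure lborel (B \<inter> {x. x \<bullet> i < c'}) - measure lborel (B \<inter> {x. x \<bullet> i < c})\<bar> \<le> L * (c' - c)"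
    using measure_halfspace_Int_Lipschitz assms by blast
  let ?F = "\<lambda>c. measure lborel (B \<inter> {x. x \<bullet> i < c})"
  have "L-lipschitz_on UNIV ?F"
  proof (rule lipschitz_onI)
    fix c c' :: real
    show "dist (?F c) (?F c') \<le> L * dist c c'"
      using L(2)[of c c'] L(2)[of c' c] by (cases "c \<le> c'") (auto simp: dist_real_def abs_minus_commute)
  qed (use L in auto)
  then have cont: "continuous_on UNIV ?F" by (rule lipschitz_on_continuous_on)
  obtain r where r: "\<And>x. x \<in> B \<Longrightarrow> norm x \<le> r" "r > 0"
    using \<open>bounded B\<close> by (auto simp: bounded_pos)
  have bd: "\<bar>x \<bullet> i\<bar> \<le> r" if "x \<in> B" for x
    using Basis_le_norm[OF \<open>i \<in> Basis\<close>, of x] r(1)[OF that] by simp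
  \<comment> \<open>The bound \<open>r\<close> is not strict: at the lower end the strict half-space
    already misses \<open>B\<close>, at the upper end one more unit is added to capture points with
    \<open>x \<bullet> i = r\<close>.\<close>
  have "B \<inter> {x. x \<bullet> i < -r} = {}" "B \<inter> {x. x \<bullet> i < r + 1} = B"
    using bd by (force simp: abs_le_iff)+
  then have "?F (-r) \<le> s" "s \<le> ?F (r + 1)" using assms by auto
  then have "\<exists>c\<ge>-r. c \<le> r + 1 \<and> ?F c = s"
    using r by (intro IVT') (auto intro: continuous_on_subset[OF cont])
  then show thesis using that by blast
qed

lemma measure_box_pos:
  fixes a b :: "'a::euclidean_space"
  assumes "box a b \<noteq> {}"
  shows "0 < measure lborel (box a b)"
  using assms by (auto simp: measure_lborel_box_eq box_eq_empty not_le inner_diff_left less_imp_le intro!: prod_pos)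

text \<open>Arithmetic-geometric mean inequality for the ratios \<open>u i / (u i + v i)\<close> and
  for \<open>v i / (u i + v i)\<close>; the two ratios add up to 1 in each coordinate. The box on
  the right has side lengths \<open>u i + v i\<close>.\<close>

lemma brunn_minkowski_box:
  fixes a b c d :: "'a::euclidean_space"
  assumes "box a b \<noteq> {}" "box c d \<noteq> {}"
  shows "(root DIM('a) (measure lborel (box a b)) + root DIM('a) (measure lborel (box c d))) ^ DIM('a)
    \<le> measure lborel (box (a + c) (b + d))"
proof -
  let ?n = "DIM('a)"
  define u v where "u i = (b - a) \<bullet> i" and "v i = (d - c) \<bullet> i" for i
  have pos: "0 < u i" "0 < v i" if "i \<in> Basis" for i
    using assms that by (auto simp: box_eq_empty u_def v_def inner_diff_left not_le)
  have m: "measure lborel (box a b) = prod u Basis" "measure lborel (box c d) = prod v Basis"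
    "measure lborel (box (a + c) (b + d)) = (\<Prod>i\<in>Basis. u i + v i)"
    using assms unfolding measure_lborel_box_eq u_def v_def box_eq_empty
    by (auto simp: not_le inner_diff_left inner_add_left less_imp_le add_mono algebra_simps intro!: prod.cong)
  define P where "P = (\<Prod>i\<in>Basis. u i + v i)"
  have P: "P > 0" unfolding P_def by (intro prod_pos) (auto intro: pos add_pos_pos)
  have *: "root ?n (prod w Basis) / root ?n P \<le> (\<Sum>i\<in>Basis. w i / (u i + v i)) / ?n"
    if "\<And>i. i \<in> Basis \<Longrightarrow> 0 < w i" for w :: "'a \<Rightarrow> real"
  proof -
    have "root ?n (prod w Basis) / root ?n P = (\<Prod>i\<in>Basis. w i / (u i + v i)) powr (1 / ?n)"
      using that pos P unfolding prod_dividef P_def[symmetric]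
      by (simp add: root_powr_inverse powr_divide prod_pos less_imp_le inverse_eq_divide)
    also have "\<dots> \<le> (\<Sum>i\<in>Basis. w i / (u i + v i) / ?n)"
      using that pos by (intro arith_geom_mean) (auto intro!: divide_nonneg_pos add_pos_pos simp: less_imp_le)
    finally show ?thesis by (simp add: sum_divide_distrib)
  qed
  have "(root ?n (prod u Basis) + root ?n (prod v Basis)) / root ?n P
      \<le> (\<Sum>i\<in>Basis. u i / (u i + v i)) / ?n + (\<Sum>i\<in>Basis. v i / (u i + v i)) / ?n"
    using *[of u] *[of v] pos by (simp add: add_divide_distrib)
  also have "\<dots> = (\<Sum>i\<in>(Basis::'a set). 1) / ?n"
  proof -
    have "u i / (u i + v i) + v i / (u i + v i) = 1" if "i \<in> Basis" for i
      using pos[OF that] by (simp flip: add_divide_distrib)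
    then show ?thesis
      unfolding add_divide_distrib[symmetric] sum.distrib[symmetric] by simp
  qed
  also have "\<dots> = 1" by simp
  finally have "root ?n (prod u Basis) + root ?n (prod v Basis) \<le> root ?n P"
    using P by (simp add: pos_divide_le_eq)
  then have "(root ?n (prod u Basis) + root ?n (prod v Basis)) ^ ?n \<le> root ?n P ^ ?n"
    using pos by (intro power_mono) (auto intro!: add_nonneg_nonneg prod_nonneg simp: less_imp_le)
  then show ?thesis
    using P unfolding m P_def by simp
qed


text \<open>Both halves are open, so that a family of open boxes is cut into families of open boxes;
  the hyperplane lost in between is a null set.\<close>

lemma measure_split_hyperplane:
  fixes A :: "'a::euclidean_space set"
  assumes "open A" "bounded A" "i \<in> Basis"
  shows "measure lborel (A \<inter> {x. x \<bullet> i < c}) + measure lborel (A \<inter> {x. c < x \<bullet> i}) = measure lborel A"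
proof -
  let ?N = "{x. x \<bullet> i = c}"
  have meas: "A \<inter> {x. x \<bullet> i < c} \<in> fmeasurable lborel" "A \<inter> {x. c < x \<bullet> i} \<in> fmeasurable lborel"
    using assms by (intro bounded_fmeasurable_lborel; auto intro: bounded_subset)+
  have "?N \<in> null_sets lebesgue"
    using negligible_standard_hyperplane[OF \<open>i \<in> Basis\<close>, of c] by (simp add: negligible_iff_null_sets)
  moreover have "?N \<in> sets lborel"
    by simp
  ultimately have "?N \<in> null_sets lborel"
    by (auto simp: null_sets_def)
  then have "measure lborel A = measure lborel (A - ?N)"
    using assms by (intro measure_Diff_null_set[symmetric]) auto
  also have "A - ?N = A \<inter> {x. x \<bullet> i < c} \<union> A \<inter> {x. c < x \<bullet> i}"
    by auto
  also have "measure lborel \<dots> = measure lborel (A \<inter> {x. x \<bullet> i < c}) + measure lborel (A \<inter> {x. c < x \<bullet> i})"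
  proof -
    have "(A \<inter> {x. x \<bullet> i < c}) \<inter> (A \<inter> {x. c < x \<bullet> i}) = {}" by auto
    then show ?thesis using measure_Un3[OF meas] by simp
  qed
  finally show ?thesis by simp
qed

lemma open_bounded_set_plus:
  fixes A B :: "'a::euclidean_space set"
  assumes "open A" "bounded A" "bounded B"
  shows "open (A + B)" "bounded (A + B)"
proof -
  have "A + B = (\<Union>x\<in>A. \<Union>y\<in>B. {x + y})"
    by (auto simp: set_plus_def)
  then show "open (A + B)" 
    using open_sums[of A B] assms by simp
  show "bounded (A + B)"
    using bounded_plus[OF assms(2,3)] by (simp add: set_plus_def case_prod_beta image_def)
qed

text \<open>Hadwiger--Ohmann: when parallel hyperplanes cut \<open>A\<close> and \<open>B\<close> in the same volume ratio, the sums of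
  corresponding pieces lie on different sides of a hyperplane.  A hyperplane separating two boxes of a
  family leaves fewer boxes on either side, which allows induction on the number of boxes.\<close>

lemma brunn_minkowski_split:
  fixes A B :: "'a::euclidean_space set"
  assumes "open A" "bounded A" "open B" "bounded B" "i \<in> Basis" "0 < t" "t < 1"
    and A: "measure lborel (A \<inter> {x. x \<bullet> i < c}) = t * measure lborel A"
    and B: "measure lborel (B \<inter> {x. x \<bullet> i < c'}) = t * measure lborel B"
    and less: "(root DIM('a) (measure lborel (A \<inter> {x. x \<bullet> i < c}))
      + root DIM('a) (measure lborel (B \<inter> {x. x \<bullet> i < c'}))) ^ DIM('a)
      \<le> measure lborel (A \<inter> {x. x \<bullet> i < c} + B \<inter> {x. x \<bullet> i < c'})"
    and greater: "(root DIM('a) (measure lborel (A \<inter> {x. c < x \<bullet> i}))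
      + root DIM('a) (measure lborel (B \<inter> {x. c' < x \<bullet> i}))) ^ DIM('a)
      \<le> measure lborel (A \<inter> {x. c < x \<bullet> i} + B \<inter> {x. c' < x \<bullet> i})"
  shows "(root DIM('a) (measure lborel A) + root DIM('a) (measure lborel B)) ^ DIM('a)
    \<le> measure lborel (A + B)"
proof -
  let ?n = "DIM('a)" and ?m = "measure (lborel :: 'a measure)"
  let ?r = "(root ?n (?m A) + root ?n (?m B)) ^ ?n"
  let ?L = "A \<inter> {x. x \<bullet> i < c} + B \<inter> {x. x \<bullet> i < c'}" and ?G = "A \<inter> {x. c < x \<bullet> i} + B \<inter> {x. c' < x \<bullet> i}"
  \<comment> \<open>The bound is homogeneous in the pair of volumes. This is why both sets are cut
    in the same ratio: the bounds for the halves are \<open>t * ?r\<close> and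
    \<open>(1 - t) * ?r\<close> and add up to \<open>?r\<close>.\<close>
  have scale: "(root ?n (s * ?m A) + root ?n (s * ?m B)) ^ ?n = s * ?r" if "0 \<le> s" for s
    using that by (simp add: real_root_mult power_mult_distrib flip: distrib_left)
  have A': "?m (A \<inter> {x. c < x \<bullet> i}) = (1 - t) * ?m A"
    using measure_split_hyperplane[of A i c] assms by (simp add: algebra_simps)
  have B': "?m (B \<inter> {x. c' < x \<bullet> i}) = (1 - t) * ?m B"
    using measure_split_hyperplane[of B i c'] assms by (simp add: algebra_simps)
  have fm: "X + Y \<in> fmeasurable lborel" if "open X" "bounded X" "bounded Y" for X Y :: "'a set"
    using open_bounded_set_plus[OF that] by (intro bounded_fmeasurable_lborel) auto
  have fmLG: "?L \<in> fmeasurable lborel" "?G \<in> fmeasurable lborel" "A + B \<in> fmeasurable lborel"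
    using assms by (intro fm; auto intro: bounded_subset open_halfspace_component_lt open_halfspace_component_gt)+
  have disj: "?L \<inter> ?G = {}"
  proof -
    have "x \<bullet> i < c + c'" if "x \<in> ?L" for x
      using that by (auto simp: set_plus_def inner_add_left)
    moreover have "c + c' < x \<bullet> i" if "x \<in> ?G" for x
      using that by (auto simp: set_plus_def inner_add_left)
    ultimately show ?thesis by (metis disjoint_iff less_asym)
  qed
  have "?r = t * ?r + (1 - t) * ?r"
    by (simp add: algebra_simps)
  also have "\<dots> = (root ?n (t * ?m A) + root ?n (t * ?m B)) ^ ?n + (root ?n ((1 - t) * ?m A) + root ?n ((1 - t) * ?m B)) ^ ?n"
    using assms(6,7) by (simp add: scale)
  also have "\<dots> \<le> ?m ?L + ?m ?G"
    using less greater unfolding A B A' B' by (rule add_mono)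
  also have "\<dots> = ?m (?L \<union> ?G)"
    using fmLG disj by (simp add: measure_Un3)
  also have "\<dots> \<le> ?m (A + B)"
  proof (rule measure_mono_fmeasurable)
    show "?L \<union> ?G \<in> sets lborel" using fmLG by (intro sets.Un fmeasurableD)
  qed (use fmLG in \<open>auto simp: set_plus_def\<close>)
  finally show ?thesis .
qed

lemma box_family_Union:
  assumes "box_family D"
  shows "open (\<Union>D)" "bounded (\<Union>D)" "D \<noteq> {} \<Longrightarrow> 0 < measure lborel (\<Union>D)"
proof -
  have box: "\<exists>a b. K = box a b \<and> box a b \<noteq> {}" if "K \<in> D" for K
    using assms that unfolding box_family_def by metis
  have fin: "finite D" using assms by (simp add: box_family_def)
  show op: "open (\<Union>D)" using box by (metis open_Union open_box)
  show bd: "bounded (\<Union>D)" using box fin by (metis bounded_Union bounded_box)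
  show "0 < measure lborel (\<Union>D)" if "D \<noteq> {}"
  proof -
    obtain K where K: "K \<in> D" using \<open>D \<noteq> {}\<close> by blast
    then have "0 < measure lborel K" using box measure_box_pos by metis
    also have "\<dots> \<le> measure lborel (\<Union>D)"
      using K op bd box[OF K] by (intro measure_mono_fmeasurable bounded_fmeasurable_lborel) auto
    finally show ?thesis .
  qed
qed

text \<open>Induction on the total number of boxes. Cutting between two boxes of one family lowers
  its count on both sides, while the matching cut of the other family never raises the count there.
  Two single boxes are the base case.\<close>

lemma brunn_minkowski_box_family:
  fixes D E :: "'a::euclidean_space set set"
  assumes "box_family D" "box_family E" "D \<noteq> {}" "E \<noteq> {}"
  shows "(root DIM('a) (measure lborel (\<Union>D)) + root DIM('a) (measure lborel (\<Union>E))) ^ DIM('a)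
    \<le> measure lborel (\<Union>D + \<Union>E)"
  using assms
proof (induction "card D + card E" arbitrary: D E rule: less_induct)
  case less
  let ?n = "DIM('a)" and ?m = "measure (lborel :: 'a measure)"
  let ?P = "\<lambda>A B :: 'a set. (root ?n (?m A) + root ?n (?m B)) ^ ?n \<le> ?m (A + B)"
  \<comment> \<open>Stated for arbitrary \<open>F\<close> and \<open>G\<close> with the same total
    count, so that it applies with \<open>D\<close> and \<open>E\<close> in either order, whichever
    contains two boxes.\<close>
  have cut: "?P (\<Union>F) (\<Union>G)"
    if FG: "box_family F" "box_family G" "G \<noteq> {}" "K \<in> F" "L \<in> F" "K \<noteq> L"
      "card F + card G = card D + card E" for F G K L
  proof -
    obtain i c K' L' where i: "i \<in> Basis" and K': "K' \<in> F" "K' \<subseteq> {x. x \<bullet> i < c}"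
      and L': "L' \<in> F" "L' \<subseteq> {x. c < x \<bullet> i}"
      using box_family_separate FG by metis
    have F: "open (\<Union>F)" "bounded (\<Union>F)" "0 < ?m (\<Union>F)"
      using box_family_Union[of F] FG by auto
    have G: "open (\<Union>G)" "bounded (\<Union>G)" "0 < ?m (\<Union>G)"
      using box_family_Union[of G] FG by auto
    obtain Fl where Fl: "box_family Fl" "\<Union>Fl = \<Union>F \<inter> {x. x \<bullet> i < c}"
      and Fl_card: "card Fl \<le> card F" "(\<exists>K\<in>F. K \<inter> {x. x \<bullet> i < c} = {}) \<longrightarrow> card Fl < card F"
      by (rule box_family_Int[OF FG(1) box_Int_halfspace_less[OF i, where c = c]])
    obtain Fg where Fg: "box_family Fg" "\<Union>Fg = \<Union>F \<inter> {x. c < x \<bullet> i}"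
      and Fg_card: "card Fg \<le> card F" "(\<exists>K\<in>F. K \<inter> {x. c < x \<bullet> i} = {}) \<longrightarrow> card Fg < card F"
      by (rule box_family_Int[OF FG(1) box_Int_halfspace_greater[OF i, where c = c]])
    have "L' \<inter> {x. x \<bullet> i < c} = {}" "K' \<inter> {x. c < x \<bullet> i} = {}"
      using K' L' by fastforce+
    then have Fl_Fg: "card Fl < card F" "card Fg < card F"
      using Fl_card(2) Fg_card(2) K'(1) L'(1) by blast+
    have ne: "K' \<noteq> {}" "L' \<noteq> {}" using K'(1) L'(1) FG(1) by (auto simp: box_family_def)
    then have "\<Union>Fl \<noteq> {}" "\<Union>Fg \<noteq> {}"
      unfolding Fl(2) Fg(2) using K' L' by blast+
    then have F_ne: "Fl \<noteq> {}" "Fg \<noteq> {}" by auto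
    define t where "t = ?m (\<Union>Fl) / ?m (\<Union>F)"
    have pos: "0 < ?m (\<Union>Fl)" "0 < ?m (\<Union>Fg)"
      using F_ne Fl Fg box_family_Union(3) by blast+
    moreover have "?m (\<Union>Fl) + ?m (\<Union>Fg) = ?m (\<Union>F)"
      unfolding Fl Fg using F i by (intro measure_split_hyperplane)
    ultimately have t: "0 < t" "t < 1" "?m (\<Union>Fl) = t * ?m (\<Union>F)"
      using F by (auto simp: t_def)
    \<comment> \<open>The hyperplane through \<open>F\<close> is dictated by its boxes; the one
      through \<open>G\<close> is free and is placed to reproduce the ratio \<open>t\<close>. It may
      run through boxes of \<open>G\<close>.\<close>
    obtain c' where c': "?m (\<Union>G \<inter> {x. x \<bullet> i < c'}) = t * ?m (\<Union>G)"
      using ex_halfspace_Int_measure_eq[of "\<Union>G" i "t * ?m (\<Union>G)"] G t i by (auto simp: mult_le_cancel_right1)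
    obtain Gl where Gl: "box_family Gl" "\<Union>Gl = \<Union>G \<inter> {x. x \<bullet> i < c'}" "card Gl \<le> card G"
      and "(\<exists>K\<in>G. K \<inter> {x. x \<bullet> i < c'} = {}) \<longrightarrow> card Gl < card G"
      by (rule box_family_Int[OF FG(2) box_Int_halfspace_less[OF i, where c = c']])
    obtain Gg where Gg: "box_family Gg" "\<Union>Gg = \<Union>G \<inter> {x. c' < x \<bullet> i}" "card Gg \<le> card G"
      and "(\<exists>K\<in>G. K \<inter> {x. c' < x \<bullet> i} = {}) \<longrightarrow> card Gg < card G"
      by (rule box_family_Int[OF FG(2) box_Int_halfspace_greater[OF i, where c = c']])
    have "?m (\<Union>Gl) + ?m (\<Union>Gg) = ?m (\<Union>G)"
      unfolding Gl Gg using G i by (intro measure_split_hyperplane)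
    then have "0 < ?m (\<Union>Gl)" "0 < ?m (\<Union>Gg)"
      using c' t G by (auto simp: Gl(2) mult_le_cancel_right1 algebra_simps)
        (smt (verit, best) mult_less_cancel_right2)
    then have G_ne: "Gl \<noteq> {}" "Gg \<noteq> {}" by auto
    have "?P (\<Union>Fl) (\<Union>Gl)" "?P (\<Union>Fg) (\<Union>Gg)"
      using Fl Fg Fl_Fg Gl Gg F_ne G_ne FG(7) by (intro less.hyps; simp)+
    note * = this[unfolded Fl(2) Fg(2) Gl(2) Gg(2)]
    show ?thesis
      by (rule brunn_minkowski_split[OF F(1,2) G(1,2) i t(1,2) t(3)[unfolded Fl(2)] c' *])
  qed
  have fin: "finite D" "finite E"
    using less.prems by (auto simp: box_family_def)
  consider K L where "K \<in> D" "L \<in> D" "K \<noteq> L" | K L where "K \<in> E" "L \<in> E" "K \<noteq> L"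
    | K L where "D = {K}" "E = {L}"
    using less.prems(3,4) by (metis is_singletonI' is_singleton_def)
  then show ?case
  proof cases
    case 1
    then show ?thesis using cut[of D E K L] less.prems by auto
  next
    case 2
    then show ?thesis using cut[of E D K L] less.prems by (auto simp: add.commute)
  next
    case 3
    then obtain a b c d where *: "K = box a b" "L = box c d" "box a b \<noteq> {}" "box c d \<noteq> {}"
      using less.prems(1,2) unfolding box_family_def by (metis singletonI)
    have "box (a + c) (b + d) \<subseteq> box a b + box c d"
    proof
      fix x assume x: "x \<in> box (a + c) (b + d)"
      \<comment> \<open>Along each axis \<open>y\<close> and \<open>x - y\<close> are put at the
        same relative position \<open>s j\<close> in their respective boxes, namely the position of
        \<open>x\<close> in the sum box.\<close>
      define s where "s j = (x \<bullet> j - a \<bullet> j - c \<bullet> j) / (b \<bullet> j - a \<bullet> j + d \<bullet> j - c \<bullet> j)" for j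
      define y where "y = (\<Sum>j\<in>Basis. (a \<bullet> j + s j * (b \<bullet> j - a \<bullet> j)) *\<^sub>R j)"
      have *: "0 < s j" "s j < 1" "a \<bullet> j < b \<bullet> j" "c \<bullet> j < d \<bullet> j"
        "x \<bullet> j - a \<bullet> j - s j * (b \<bullet> j - a \<bullet> j) = c \<bullet> j + s j * (d \<bullet> j - c \<bullet> j)" if j: "j \<in> Basis" for j
      proof -
        show l: "a \<bullet> j < b \<bullet> j" "c \<bullet> j < d \<bullet> j"
          using * j by (auto simp: box_eq_empty not_le)
        show "0 < s j" "s j < 1"
          using l x j by (auto simp: s_def mem_box inner_add_left add.commute divide_simps)
        have "s j * (b \<bullet> j - a \<bullet> j + d \<bullet> j - c \<bullet> j) = x \<bullet> j - a \<bullet> j - c \<bullet> j"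
          using l by (simp add: s_def)
        then show "x \<bullet> j - a \<bullet> j - s j * (b \<bullet> j - a \<bullet> j) = c \<bullet> j + s j * (d \<bullet> j - c \<bullet> j)"
          by (simp add: algebra_simps)
      qed
      have conv: "u < u + r * (v - u)" "u + r * (v - u) < v" if "0 < r" "r < 1" "u < v" for u v r :: real
      proof -
        have "0 < r * (v - u)" "0 < (1 - r) * (v - u)" using that by auto
        then show "u < u + r * (v - u)" "u + r * (v - u) < v" by (auto simp: algebra_simps)
      qed
      have "y \<in> box a b"
        using * conv by (simp add: mem_box y_def)
      moreover have "x - y \<in> box c d"
        using * conv by (simp add: mem_box y_def inner_diff_left diff_diff_eq[symmetric])
      ultimately show "x \<in> box a b + box c d"
        by (metis add.commute diff_add_cancel set_plus_intro)
    qed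
    moreover have "box a b + box c d \<in> fmeasurable lborel"
      using open_bounded_set_plus[OF open_box bounded_box bounded_box, of a b c d] by (intro bounded_fmeasurable_lborel) auto
    ultimately have "?m (box (a + c) (b + d)) \<le> ?m (box a b + box c d)"
      by (intro measure_mono_fmeasurable) (auto simp: fmeasurableD)
    then show ?thesis
      using brunn_minkowski_box[OF *(3,4)] by (simp add: 3 *)
  qed
qed

section \<open>Passage from boxes to open sets and convex dilations\<close>

lemma open_inner_box_family:
  fixes A :: "'a::euclidean_space set"
  assumes "open A" "bounded A" "0 < e"
  obtains D where "box_family D" "\<Union>D \<subseteq> A" "measure lborel A - e < measure lborel (\<Union>D)"
proof (cases "A = {}")
  case True
  then show thesis
    by (intro that[of "{}"]) (use assms in \<open>auto simp: box_family_def\<close>)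
next
  case False
  obtain a where a: "A \<subseteq> box (-a) a"
    using bounded_subset_box_symmetric \<open>bounded A\<close> by blast
  \<comment> \<open>Each covering box is contained in \<open>g x\<close> for some point
    \<open>x\<close> of \<open>A\<close>; with this gauge it lies inside \<open>A\<close>.\<close>
  define g where "g x = (if x \<in> A then A else UNIV)" for x
  have "gauge g"
    using \<open>open A\<close> by (auto simp: gauge_def g_def)
  moreover have "A \<subseteq> cbox (-a) a" "box (-a) a \<noteq> {}"
    using a False box_subset_cbox by blast+
  ultimately obtain D where "countable D" and D_box: "\<And>K. K \<in> D \<Longrightarrow> interior K \<noteq> {} \<and> (\<exists>c d. K = cbox c d)"
    and pw: "pairwise (\<lambda>A B. interior A \<inter> interior B = {}) D"
    and D_g: "\<And>K. K \<in> D \<Longrightarrow> \<exists>x \<in> A \<inter> K. K \<subseteq> g x"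
    and A_D: "A \<subseteq> \<Union>D"
    using covering_lemma by metis
  have D_A: "K \<subseteq> A" if "K \<in> D" for K
    using D_g[OF that] by (auto simp: g_def)
  define S where "S n = \<Union>(interior ` (from_nat_into D ` {..<n}))" for n
  have "D \<noteq> {}" using False A_D by auto
  then have ran: "range (from_nat_into D) = D"
    using \<open>countable D\<close> by (rule range_from_nat_into)
  have fam: "box_family (interior ` (from_nat_into D ` {..<n}))" for n
    unfolding box_family_def
  proof (intro conjI ballI)
    show "disjoint (interior ` (from_nat_into D ` {..<n}))"
    proof -
      have "from_nat_into D ` {..<n} \<subseteq> D" using ran by blast
      then have "interior K \<inter> interior L = {}"
        if "K \<in> from_nat_into D ` {..<n}" "L \<in> from_nat_into D ` {..<n}" "interior K \<noteq> interior L" for K L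
        using pairwiseD[OF pw, of K L] that by blast
      then show ?thesis unfolding disjoint_def by (metis (no_types, lifting) imageE)
    qed
    fix K assume "K \<in> interior ` (from_nat_into D ` {..<n})"
    then obtain L where "K = interior L" "L \<in> D" using ran by auto
    then show "K \<noteq> {}" "\<exists>a b. K = box a b"
      using D_box by (auto, metis interior_cbox)
  qed auto
  have SA: "(\<Union>n. S n) \<subseteq> A"
    using D_A interior_subset ran unfolding S_def by blast
  have US: "(\<Union>n. S n) = \<Union>(interior ` D)"
    unfolding S_def by (subst (2) ran[symmetric]) auto
  have fmA: "A \<in> fmeasurable lborel"
    using assms by (intro bounded_fmeasurable_lborel) auto
  have opS: "open (S n)" for n by (auto simp: S_def)
  \<comment> \<open>Passing from the closed boxes to their interiors loses only countably many
    frontiers of convex sets, which are negligible.\<close>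
  have "A - (\<Union>n. S n) \<subseteq> (\<Union>K\<in>D. frontier K)"
  proof
    fix x assume x: "x \<in> A - (\<Union>n. S n)"
    then obtain K where "K \<in> D" "x \<in> K" using A_D by auto
    moreover have "x \<notin> interior K" using x \<open>K \<in> D\<close> unfolding US by blast
    ultimately show "x \<in> (\<Union>K\<in>D. frontier K)"
      using closure_subset[of K] by (auto simp: frontier_def)
  qed
  moreover have "(\<Union>K\<in>D. frontier K) \<in> null_sets lebesgue"
  proof (rule null_sets_UN')
    fix K assume "K \<in> D"
    then have "convex K" using D_box convex_box(1) by metis
    then show "frontier K \<in> null_sets lebesgue"
      using negligible_convex_frontier negligible_iff_null_sets by blast
  qed fact
  ultimately have "A - (\<Union>n. S n) \<in> null_sets lebesgue"
    by (metis negligible_iff_null_sets negligible_subset)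
  moreover have "A - (\<Union>n. S n) \<in> sets lborel"
    using \<open>open A\<close> opS by auto
  ultimately have null: "A - (\<Union>n. S n) \<in> null_sets lborel"
    by (auto simp: null_sets_def)
  have "measure lborel A = measure lborel (A - (A - (\<Union>n. S n)))"
    using \<open>open A\<close> null by (intro measure_Diff_null_set[symmetric]) auto
  also have "A - (A - (\<Union>n. S n)) = (\<Union>n. S n)"
    using SA by auto
  finally have eq: "measure lborel A = measure lborel (\<Union>n. S n)" .
  have "(\<lambda>n. measure lborel (S n)) \<longlonglongrightarrow> measure lborel (\<Union>n. S n)"
  proof (rule Lim_measure_incseq)
    show "incseq S" by (intro monoI) (force simp: S_def)
    have "emeasure lborel (\<Union>n. S n) \<le> emeasure lborel A"
      using SA \<open>open A\<close> by (intro emeasure_mono) auto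
    then show "emeasure lborel (\<Union>n. S n) \<noteq> \<infinity>"
      using fmA by (auto simp: fmeasurable_def top_unique)
  qed (use opS in auto)
  then have "\<forall>\<^sub>F n in sequentially. measure lborel A - e < measure lborel (S n)"
    using \<open>0 < e\<close> by (intro order_tendstoD(1)) (auto simp: eq)
  then obtain n where "measure lborel A - e < measure lborel (S n)"
    by (auto simp: eventually_sequentially)
  then show thesis
    using fam[of n] SA by (intro that[of "interior ` (from_nat_into D ` {..<n})"]) (auto simp: S_def)
qed

lemma open_measure_lborel_pos:
  fixes A :: "'a::euclidean_space set"
  assumes "open A" "A \<noteq> {}" "bounded A"
  shows "0 < measure lborel A"
proof -
  obtain x where "x \<in> A" using assms by blast
  then obtain a b where ab: "x \<in> box a b" "box a b \<subseteq> A"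
    using \<open>open A\<close> by (metis open_contains_box)
  then have "0 < measure lborel (box a b)" using measure_box_pos by blast
  also have "\<dots> \<le> measure lborel A"
    using ab assms by (intro measure_mono_fmeasurable bounded_fmeasurable_lborel) auto
  finally show ?thesis .
qed

text \<open>Inner approximation is enough: the sums of the approximating unions stay inside
  \<open>A + B\<close>, so only the left-hand side requires a limit.\<close>

theorem brunn_minkowski_open:
  fixes A B :: "'a::euclidean_space set"
  assumes A: "open A" "bounded A" "A \<noteq> {}" and B: "open B" "bounded B" "B \<noteq> {}"
  shows "(root DIM('a) (measure lborel A) + root DIM('a) (measure lborel B)) ^ DIM('a)
    \<le> measure lborel (A + B)"
proof -
  let ?n = "DIM('a)" and ?m = "measure (lborel :: 'a measure)"
  have approx: "\<exists>D. (\<forall>k. box_family (D k) \<and> D k \<noteq> {} \<and> \<Union>(D k) \<subseteq> X) \<and> (\<lambda>k. ?m (\<Union>(D k))) \<longlonglongrightarrow> ?m X"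
    if X: "open X" "bounded X" "X \<noteq> {}" for X :: "'a set"
  proof -
    have pos: "0 < ?m X" using open_measure_lborel_pos X by blast
    \<comment> \<open>The error is a fraction of the volume of \<open>X\<close>, at most all of it,
      so even for \<open>k = 0\<close> the union has positive volume and the family is
      nonempty.\<close>
    have "\<exists>D. box_family D \<and> \<Union>D \<subseteq> X \<and> ?m X - ?m X / real (Suc k) < ?m (\<Union>D)" for k
      using open_inner_box_family[OF X(1,2), of "?m X / real (Suc k)"] pos by (metis divide_pos_pos of_nat_0_less_iff zero_less_Suc)
    then obtain D where D: "\<And>k. box_family (D k)" "\<And>k. \<Union>(D k) \<subseteq> X"
      "\<And>k. ?m X - ?m X / real (Suc k) < ?m (\<Union>(D k))" by metis
    have "?m X / real (Suc k) \<le> ?m X" for k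
      using pos by (simp add: field_simps)
    then have ne: "D k \<noteq> {}" for k
      using D(3)[of k] by (smt (verit, best) Sup_empty measure_empty)
    have "(\<lambda>k. ?m (\<Union>(D k))) \<longlonglongrightarrow> ?m X"
    proof (rule tendsto_sandwich)
      show "(\<lambda>k. ?m X - ?m X / real (Suc k)) \<longlonglongrightarrow> ?m X"
        using tendsto_diff[OF tendsto_const[of "?m X"] LIMSEQ_Suc[OF lim_const_over_n[of "?m X"]]] by simp
      show "\<forall>\<^sub>F k in sequentially. ?m (\<Union>(D k)) \<le> ?m X"
        using D(2) X box_family_Union(1)[OF D(1)]
        by (intro always_eventually allI measure_mono_fmeasurable bounded_fmeasurable_lborel) auto
    qed (use D(3) in \<open>auto intro!: always_eventually less_imp_le\<close>)
    then show ?thesis using D ne by blast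
  qed
  obtain D where D: "\<And>k. box_family (D k)" "\<And>k. D k \<noteq> {}" "\<And>k. \<Union>(D k) \<subseteq> A" "(\<lambda>k. ?m (\<Union>(D k))) \<longlonglongrightarrow> ?m A"
    using approx[OF A] by blast
  obtain E where E: "\<And>k. box_family (E k)" "\<And>k. E k \<noteq> {}" "\<And>k. \<Union>(E k) \<subseteq> B" "(\<lambda>k. ?m (\<Union>(E k))) \<longlonglongrightarrow> ?m B"
    using approx[OF B] by blast
  have AB: "A + B \<in> fmeasurable lborel"
    using open_bounded_set_plus A B by (intro bounded_fmeasurable_lborel) auto
  have "(\<lambda>k. (root ?n (?m (\<Union>(D k))) + root ?n (?m (\<Union>(E k)))) ^ ?n)
      \<longlonglongrightarrow> (root ?n (?m A) + root ?n (?m B)) ^ ?n"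
    by (intro tendsto_intros D E)
  moreover have "(root ?n (?m (\<Union>(D k))) + root ?n (?m (\<Union>(E k)))) ^ ?n \<le> ?m (A + B)" for k
  proof -
    have "(root ?n (?m (\<Union>(D k))) + root ?n (?m (\<Union>(E k)))) ^ ?n \<le> ?m (\<Union>(D k) + \<Union>(E k))"
      by (intro brunn_minkowski_box_family D E)
    also have "\<dots> \<le> ?m (A + B)"
    proof (rule measure_mono_fmeasurable)
      show "\<Union>(D k) + \<Union>(E k) \<subseteq> A + B" using D(3) E(3) by (intro set_plus_mono2)
      show "\<Union>(D k) + \<Union>(E k) \<in> sets lborel"
        using open_bounded_set_plus(1)[of "\<Union>(D k)" "\<Union>(E k)"] box_family_Union[OF D(1)] box_family_Union[OF E(1)]
        by simp
    qed (rule AB)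
    finally show ?thesis .
  qed
  ultimately show ?thesis by (intro LIMSEQ_le_const2) auto
qed

text \<open>The dual unit ball is not open, so the inequality is applied to its interior, which has
  the same volume because the frontier of a convex set is negligible. The target \<open>S\<close> is
  any measurable set containing the dilation, which leaves the measurability of the sum with
  \<open>B\<close> itself out of the matter.\<close>

lemma brunn_minkowski_convex_dilation:
  fixes A B S :: "'a::euclidean_space set"
  assumes A: "open A" "bounded A" "A \<noteq> {}" and B: "convex B" "bounded B" "0 < measure lebesgue B"
    and "0 < e" and S: "S \<in> fmeasurable lborel"
    and sub: "\<And>x y. x \<in> A \<Longrightarrow> y \<in> B \<Longrightarrow> x + e *\<^sub>R y \<in> S"
  shows "(root DIM('a) (measure lborel A) + e * root DIM('a) (measure lebesgue B)) ^ DIM('a)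
    \<le> measure lborel S"
proof -
  let ?n = "DIM('a)"
  let ?I = "interior B" and ?J = "(\<lambda>x. e *\<^sub>R x + 0) ` interior B"
  have meas_I: "measure lebesgue ?I = measure lebesgue B"
    using B by (intro measure_interior negligible_convex_frontier)
  then have neI: "?I \<noteq> {}" using B(3) by auto
  have J: "open ?J" "bounded ?J" "?J \<noteq> {}"
    using open_affinity[of ?I e 0] \<open>0 < e\<close> neI B(2) bounded_scaling[of ?I e] interior_subset
    by (auto simp: add.commute intro: bounded_subset)
  have "measure lborel ?J = measure lebesgue ?J"
    using J by simp
  also have "\<dots> = e ^ ?n * measure lebesgue ?I"
    using \<open>0 < e\<close> measure_lebesgue_affine[of e 0 ?I] by simp
  finally have "root ?n (measure lborel ?J) = e * root ?n (measure lebesgue B)"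
    using \<open>0 < e\<close> by (simp add: meas_I real_root_mult real_root_power_cancel)
  then have "(root ?n (measure lborel A) + e * root ?n (measure lebesgue B)) ^ ?n \<le> measure lborel (A + ?J)"
    using brunn_minkowski_open[OF A J] by simp
  also have "\<dots> \<le> measure lborel S"
  proof (rule measure_mono_fmeasurable)
    show "A + ?J \<subseteq> S" using sub interior_subset by (fastforce simp: set_plus_def)
    show "A + ?J \<in> sets lborel" using open_bounded_set_plus(1)[OF A(1,2) J(2)] by (simp only: borel_open sets_lborel)
  qed (rule S)
  finally show ?thesis .
qed

section \<open>Norms and gradients\<close>

lemma is_norm_le_norm:
  fixes H :: "'a::euclidean_space \<Rightarrow> real"
  assumes "is_norm H"
  obtains C where "0 < C" "\<And>x. H x \<le> C * norm x"
proof
  have sub: "H (x + y) \<le> H x + H y" and hom: "H (c *\<^sub>R x) = \<bar>c\<bar> * H x" and nn: "0 \<le> H x" for x y c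
    using assms by (auto simp: is_norm_def)
  have sum_le: "H (sum g A) \<le> (\<Sum>i\<in>A. H (g i))" if "finite A" for g :: "'a \<Rightarrow> 'a" and A
    using that
  proof induction
    case empty
    have "H 0 = 0" using assms unfolding is_norm_def by blast
    then show ?case by simp
  next
    case (insert i A)
    then show ?case using sub[of "g i" "sum g A"] by simp
  qed
  show "0 < (\<Sum>b\<in>(Basis::'a set). H b) + 1"
    using nn by (simp add: add_nonneg_pos sum_nonneg)
  fix x :: 'a
  have "H x = H (\<Sum>b\<in>Basis. (x \<bullet> b) *\<^sub>R b)"
    by (simp add: euclidean_representation)
  also have "\<dots> \<le> (\<Sum>b\<in>Basis. \<bar>x \<bullet> b\<bar> * H b)"
    using sum_le[of Basis "\<lambda>b. (x \<bullet> b) *\<^sub>R b"] by (simp add: hom)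
  also have "\<dots> \<le> (\<Sum>b\<in>Basis. norm x * H b)"
    by (intro sum_mono mult_right_mono Basis_le_norm nn)
  also have "\<dots> \<le> ((\<Sum>b\<in>Basis. H b) + 1) * norm x"
    by (simp add: sum_distrib_left algebra_simps)
  finally show "H x \<le> ((\<Sum>b\<in>Basis. H b) + 1) * norm x" .
qed

lemma is_norm_continuous:
  fixes H :: "'a::euclidean_space \<Rightarrow> real"
  assumes "is_norm H"
  shows "continuous_on UNIV H"
proof -
  obtain C where C: "0 < C" "\<And>x. H x \<le> C * norm x"
    using is_norm_le_norm assms by blast
  have "\<bar>H x - H y\<bar> \<le> H (x - y)" for x y
  proof -
    have "H (y - x) = H (x - y)"
      using assms unfolding is_norm_def by (metis abs_minus_cancel abs_one minus_diff_eq mult_1 scaleR_minus1_left)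
    moreover have "H x \<le> H (x - y) + H y" "H y \<le> H (y - x) + H x"
      using assms unfolding is_norm_def by (metis diff_add_cancel)+
    ultimately show ?thesis by linarith
  qed
  then have "C-lipschitz_on UNIV H"
    using C by (intro lipschitz_onI) (auto simp: dist_real_def dist_norm intro: order_trans)
  then show ?thesis by (rule lipschitz_on_continuous_on)
qed

text \<open>By compactness \<open>H\<close> attains a positive minimum on the Euclidean unit sphere.
  The bound makes the supremum defining \<open>dual_norm\<close> finite.\<close>

lemma is_norm_ge_norm:
  fixes H :: "'a::euclidean_space \<Rightarrow> real"
  assumes "is_norm H"
  obtains c where "0 < c" "\<And>x. c * norm x \<le> H x"
proof -
  have "continuous_on (sphere 0 1) H"
    using is_norm_continuous[OF assms] by (rule continuous_on_subset) auto
  moreover obtain b :: 'a where "b \<in> Basis" using nonempty_Basis by blast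
  then have "b \<in> sphere 0 1" by simp
  ultimately obtain z where z: "norm z = 1" "\<And>x. norm x = 1 \<Longrightarrow> H z \<le> H x"
    using continuous_attains_inf[of "sphere (0::'a) 1" H] by auto
  show thesis
  proof
    have "z \<noteq> 0" using z by auto
    then show "0 < H z" using assms unfolding is_norm_def by (metis order_le_less)
    fix x
    show "H z * norm x \<le> H x"
    proof (cases "x = 0")
      case False
      then have "H z \<le> H ((1 / norm x) *\<^sub>R x)" by (intro z) simp
      also have "\<dots> = H x / norm x" using assms by (simp add: is_norm_def)
      finally show ?thesis using False by (simp add: field_simps)
    qed (use assms in \<open>simp add: is_norm_def\<close>)
  qed
qed

text \<open>Homogeneity turns the supremum over the unit ball of \<open>H\<close> into linear
  inequalities indexed by all \<open>z\<close>. Everything about the dual norm is derived from this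
  description of its unit ball.\<close>

lemma dual_norm_le_one_iff:
  fixes H :: "'a::euclidean_space \<Rightarrow> real"
  assumes "is_norm H"
  shows "dual_norm H y \<le> 1 \<longleftrightarrow> (\<forall>z. \<bar>y \<bullet> z\<bar> \<le> H z)"
proof -
  have hom: "H (c *\<^sub>R x) = \<bar>c\<bar> * H x" for x c using assms by (simp add: is_norm_def)
  have zero: "H 0 = 0" using assms by (simp add: is_norm_def)
  obtain c where c: "0 < c" "\<And>x. c * norm x \<le> H x"
    using is_norm_ge_norm assms by blast
  have "bdd_above ((\<lambda>z. \<bar>y \<bullet> z\<bar>) ` {z. H z \<le> 1})"
  proof (rule bdd_aboveI2)
    fix z assume "z \<in> {z. H z \<le> 1}"
    then have "norm z \<le> 1 / c" using c(2)[of z] c(1) by (simp add: field_simps)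
    then have "norm y * norm z \<le> norm y * (1 / c)" by (intro mult_left_mono) auto
    then show "\<bar>y \<bullet> z\<bar> \<le> norm y * (1 / c)"
      using Cauchy_Schwarz_ineq2[of y z] by linarith
  qed
  moreover have "{z. H z \<le> 1} \<noteq> {}" using zero by (auto intro!: exI[of _ 0])
  ultimately have "dual_norm H y \<le> 1 \<longleftrightarrow> (\<forall>z. H z \<le> 1 \<longrightarrow> \<bar>y \<bullet> z\<bar> \<le> 1)"
    unfolding dual_norm_def by (subst cSUP_le_iff) auto
  also have "\<dots> \<longleftrightarrow> (\<forall>z. \<bar>y \<bullet> z\<bar> \<le> H z)"
  proof safe
    fix z assume *: "\<forall>z. H z \<le> 1 \<longrightarrow> \<bar>y \<bullet> z\<bar> \<le> 1"
    show "\<bar>y \<bullet> z\<bar> \<le> H z"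
    proof (cases "z = 0")
      case False
      then have pos: "0 < H z" using assms unfolding is_norm_def by (metis order_le_less)
      then have "\<bar>y \<bullet> ((1 / H z) *\<^sub>R z)\<bar> \<le> 1"
        by (intro *[rule_format]) (simp add: hom)
      then show ?thesis using pos by (simp add: field_simps abs_mult)
    qed (simp add: zero)
  next
    fix z assume "\<forall>z. \<bar>y \<bullet> z\<bar> \<le> H z" "H z \<le> 1"
    then show "\<bar>y \<bullet> z\<bar> \<le> 1" using order_trans by blast
  qed
  finally show ?thesis .
qed

text \<open>The ball is an intersection of slabs, one for each \<open>z\<close>, hence convex;
  testing with \<open>z = y\<close> bounds it.\<close>

lemma dual_norm_unit_ball:
  fixes H :: "'a::euclidean_space \<Rightarrow> real"
  assumes "is_norm H"
  shows "convex {y. dual_norm H y \<le> 1}" "bounded {y. dual_norm H y \<le> 1}"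
proof -
  have "{y. dual_norm H y \<le> 1} = (\<Inter>z. {y. z \<bullet> y \<le> H z} \<inter> {y. z \<bullet> y \<ge> - H z})"
    by (auto simp: dual_norm_le_one_iff[OF assms] abs_le_iff inner_commute minus_le_iff)
  moreover have "convex \<dots>"
    by (intro convex_INT convex_Int convex_halfspace_le convex_halfspace_ge)
  ultimately show "convex {y. dual_norm H y \<le> 1}" by simp
  obtain C where C: "0 < C" "\<And>x. H x \<le> C * norm x"
    using is_norm_le_norm assms by blast
  have "norm y \<le> C" if "dual_norm H y \<le> 1" for y
  proof -
    have "\<bar>y \<bullet> y\<bar> \<le> C * norm y"
      using that C(2)[of y] order_trans unfolding dual_norm_le_one_iff[OF assms] by blast
    then have "norm y * norm y \<le> C * norm y"
      by (simp add: power2_norm_eq_inner flip: power2_eq_square)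
    then show ?thesis using C(1) by (cases "y = 0") auto
  qed
  then show "bounded {y. dual_norm H y \<le> 1}" by (auto simp: bounded_iff)
qed

text \<open>\<open>gradient\<close> is a definite description, so a vector with the required
  property has to be exhibited and shown unique. It is assembled from the partial derivatives, whose
  continuity is the \<open>Ck\<close> condition of order one.\<close>

lemma test_function_gradient:
  fixes f :: "'a::euclidean_space \<Rightarrow> real"
  assumes "test_function f"
  shows "(f has_derivative (\<lambda>h. h \<bullet> gradient f x)) (at x)" "continuous_on UNIV (gradient f)"
proof -
  define D where "D x = (\<Sum>b\<in>Basis. frechet_derivative f (at x) b *\<^sub>R b)" for x
  have C1: "Ck (Suc 0) f" using assms unfolding test_function_def by blast
  then have diff: "(f has_derivative frechet_derivative f (at x)) (at x)" for x
    by (simp add: frechet_derivative_works)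
  have "frechet_derivative f (at x) = (\<lambda>h. h \<bullet> D x)" for x
  proof
    fix h
    interpret linear "frechet_derivative f (at x)"
      using diff has_derivative_linear by blast
    have "frechet_derivative f (at x) h = frechet_derivative f (at x) (\<Sum>b\<in>Basis. (h \<bullet> b) *\<^sub>R b)"
      by (simp add: euclidean_representation)
    then show "frechet_derivative f (at x) h = h \<bullet> D x"
      by (simp add: D_def sum scale inner_sum_right mult.commute)
  qed
  then have der: "GDERIV f x :> D x" for x
    using diff by (simp add: gderiv_def)
  have "gradient f x = D x" for x
    unfolding gradient_def
  proof (rule the_equality)
    fix E assume "GDERIV f x :> E"
    then have "(\<lambda>h. h \<bullet> E) = (\<lambda>h. h \<bullet> D x)"
      using der[of x] unfolding gderiv_def by (rule has_derivative_unique)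
    then show "E = D x" by (metis euclidean_eqI inner_commute)
  qed (rule der)
  then have eq: "gradient f = D" ..
  show "(f has_derivative (\<lambda>h. h \<bullet> gradient f x)) (at x)"
    using der by (simp add: eq gderiv_def)
  show "continuous_on UNIV (gradient f)"
    unfolding eq D_def using C1 by (intro continuous_intros) simp
qed

lemma test_function_support:
  fixes f :: "'a::euclidean_space \<Rightarrow> real"
  assumes "test_function f"
  shows "bounded {x. f x \<noteq> 0}"
proof -
  have "bounded (closure (support_on UNIV f))"
    using assms by (auto simp: test_function_def compact_imp_bounded)
  moreover have "{x. f x \<noteq> 0} \<subseteq> closure (support_on UNIV f)"
    using closure_subset[of "support_on UNIV f"] by (auto simp: support_on_def subset_iff)
  ultimately show ?thesis using bounded_subset by blast
qed

text \<open>Mean value theorem along the segment from \<open>x\<close> to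
  \<open>x + \<epsilon> *\<^sub>R y\<close>: duality bounds the slope by \<open>H\<close> of the
  gradient at \<open>x\<close>, and uniform continuity of the gradient on a ball bounds the change
  of gradient along the way by \<eta>. The point is that \<delta> is independent of \<open>x\<close>
  and \<open>y\<close>. Since the increment is bounded in absolute value, the estimate passes to
  \<bar>f\<bar>, which need not be differentiable.\<close>

lemma uniform_descent:
  fixes f :: "'a::euclidean_space \<Rightarrow> real"
  assumes H: "is_norm H" and f: "test_function f" and "0 < \<eta>"
  shows "\<exists>\<delta>>0. \<forall>\<epsilon>. 0 < \<epsilon> \<and> \<epsilon> < \<delta> \<longrightarrow>
    (\<forall>x y. f x \<noteq> 0 \<longrightarrow> dual_norm H y \<le> 1 \<longrightarrow> \<bar>f x\<bar> - \<epsilon> * (H (gradient f x) + \<eta>) \<le> \<bar>f (x + \<epsilon> *\<^sub>R y)\<bar>)"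
proof -
  obtain R where R: "\<And>x. f x \<noteq> 0 \<Longrightarrow> norm x \<le> R"
    using test_function_support[OF f] by (auto simp: bounded_iff)
  obtain C where C: "\<And>y. dual_norm H y \<le> 1 \<Longrightarrow> norm y \<le> C" "0 < C"
    using dual_norm_unit_ball(2)[OF H] by (auto simp: bounded_pos)
  have "uniformly_continuous_on (cball 0 (R + C)) (gradient f)"
    using test_function_gradient(2)[OF f] compact_cball
    by (intro compact_uniformly_continuous) (auto intro: continuous_on_subset)
  then obtain r where r: "0 < r" "\<And>x z. x \<in> cball 0 (R + C) \<Longrightarrow> z \<in> cball 0 (R + C) \<Longrightarrow> dist z x < r \<Longrightarrow>
      dist (gradient f z) (gradient f x) < \<eta> / C"
    using \<open>0 < \<eta>\<close> C(2) unfolding uniformly_continuous_on_def by (metis divide_pos_pos)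
  show ?thesis
  \<comment> \<open>The bound 1 keeps the segment inside the ball of radius \<open>R + C\<close>;
    the bound \<open>r / C\<close> keeps it within distance \<open>r\<close> of
    \<open>x\<close>.\<close>
  proof (rule exI[of _ "min 1 (r / C)"], intro conjI allI impI)
    fix \<epsilon> x y assume \<epsilon>: "0 < \<epsilon> \<and> \<epsilon> < min 1 (r / C)" and x: "f x \<noteq> 0" and y: "dual_norm H y \<le> 1"
    define g where "g s = f (x + s *\<^sub>R y)" for s
    have "(g has_derivative (\<lambda>h. h * (y \<bullet> gradient f (x + s *\<^sub>R y)))) (at s within {0..\<epsilon>})" for s
    proof -
      have "(g has_derivative (\<lambda>h. (h *\<^sub>R y) \<bullet> gradient f (x + s *\<^sub>R y))) (at s within {0..\<epsilon>})"
        unfolding g_def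
        by (rule has_derivative_compose[of "\<lambda>s. x + s *\<^sub>R y", OF _ test_function_gradient(1)[OF f]])
          (auto intro!: derivative_eq_intros)
      then show ?thesis by simp
    qed
    then obtain s where s: "0 < s" "s < \<epsilon>" "g \<epsilon> - g 0 = (\<epsilon> - 0) * (y \<bullet> gradient f (x + s *\<^sub>R y))"
      using mvt_simple[of 0 \<epsilon> g "\<lambda>s h. h * (y \<bullet> gradient f (x + s *\<^sub>R y))"] \<epsilon> by auto
    have ny: "norm y \<le> C" "norm x \<le> R" using C y R x by auto
    have "s * norm y \<le> 1 * C" using s \<epsilon> ny by (intro mult_mono) auto
    then have mem: "x + s *\<^sub>R y \<in> cball 0 (R + C)" "x \<in> cball 0 (R + C)"
      using ny s norm_triangle_ineq[of x "s *\<^sub>R y"] C(2) by auto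
    have "dist (x + s *\<^sub>R y) x = s * norm y" using s by (simp add: dist_norm)
    also have "\<dots> \<le> s * C" using s ny by (intro mult_left_mono) auto
    also have "\<dots> < r / C * C" using s \<epsilon> C(2) by (intro mult_strict_right_mono) auto
    also have "\<dots> = r" using C by simp
    finally have close: "dist (gradient f (x + s *\<^sub>R y)) (gradient f x) < \<eta> / C"
      using r(2) mem by blast
    have "\<bar>y \<bullet> gradient f (x + s *\<^sub>R y)\<bar> \<le> \<bar>y \<bullet> gradient f x\<bar> + \<bar>y \<bullet> (gradient f (x + s *\<^sub>R y) - gradient f x)\<bar>"
      by (simp add: inner_diff_right)
    also have "\<bar>y \<bullet> gradient f x\<bar> \<le> H (gradient f x)"
      using y by (simp add: dual_norm_le_one_iff[OF H])
    also have "\<bar>y \<bullet> (gradient f (x + s *\<^sub>R y) - gradient f x)\<bar> \<le> norm y * norm (gradient f (x + s *\<^sub>R y) - gradient f x)"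
      by (rule Cauchy_Schwarz_ineq2)
    also have "\<dots> \<le> C * (\<eta> / C)"
      using ny close C by (intro mult_mono) (auto simp: dist_norm less_imp_le)
    also have "C * (\<eta> / C) = \<eta>" using C by simp
    finally have "\<bar>y \<bullet> gradient f (x + s *\<^sub>R y)\<bar> \<le> H (gradient f x) + \<eta>" by simp
    then have "\<epsilon> * \<bar>y \<bullet> gradient f (x + s *\<^sub>R y)\<bar> \<le> \<epsilon> * (H (gradient f x) + \<eta>)"
      using \<epsilon> by (intro mult_left_mono) auto
    moreover have "\<bar>g \<epsilon> - g 0\<bar> = \<epsilon> * \<bar>y \<bullet> gradient f (x + s *\<^sub>R y)\<bar>"
      using \<epsilon> unfolding s(3) by (simp add: abs_mult)
    ultimately show "\<bar>f x\<bar> - \<epsilon> * (H (gradient f x) + \<eta>) \<le> \<bar>f (x + \<epsilon> *\<^sub>R y)\<bar>"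
      by (simp add: g_def)
  qed (use r C in auto)
qed

section \<open>Weighted isoperimetric inequality\<close>

text \<open>Convexity of the power: its graph lies above the tangent at \<open>b\<close>. With x =
  a/b - 1 \<ge> -1 this is Bernoulli's inequality.\<close>

lemma power_diff_ge_tangent:
  fixes a b :: real
  assumes "0 \<le> b" "0 \<le> a" "1 \<le> n"
  shows "real n * b ^ (n - 1) * (a - b) \<le> a ^ n - b ^ n"
proof (cases "b = 0")
  case True
  then show ?thesis using assms by (cases "n = 1") (auto simp: power_0_left)
next
  case False
  then have b: "0 < b" using assms by simp
  have "1 + real n * (a / b - 1) \<le> (1 + (a / b - 1)) ^ n"
    using b assms by (intro Bernoulli_inequality) auto
  then have "b ^ n * (1 + real n * (a / b - 1)) \<le> b ^ n * (a / b) ^ n"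
    using b by simp
  also have "\<dots> = a ^ n" using b by (simp add: power_divide)
  also have "b ^ n * (1 + real n * (a / b - 1)) = b ^ n + real n * b ^ (n - 1) * (a - b)"
    using b \<open>1 \<le> n\<close> by (cases n) (auto simp: field_simps)
  finally show ?thesis by simp
qed

text \<open>The strip is \<open>S - A\<close>. Points of \<open>A\<close> stay in \<open>S\<close>
  after moving by \<open>e\<close> times a vector of \<open>B\<close>, so Brunn-Minkowski gives
  |A|^(1/n) \<le> |S|^(1/n) - e w. The difference of the n-th powers is then bounded below by the
  tangent at the smaller value, where the factor \<open>e\<close> appears linearly.\<close>

lemma measure_superlevel_strip_ge:
  fixes F k :: "'a::euclidean_space \<Rightarrow> real" and B :: "'a set"
  defines "n \<equiv> DIM('a)"
  defines "w \<equiv> root n (measure lebesgue B)"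
  assumes n: "2 \<le> n"
    and F: "continuous_on UNIV F" "bounded {x. 0 < F x}"
    and k: "continuous_on UNIV k" "\<And>x. 0 \<le> k x"
    and B: "convex B" "bounded B" "0 < measure lebesgue B"
    and "0 < e" "0 < t"
    and descent: "\<And>x y. 0 < F x \<Longrightarrow> y \<in> B \<Longrightarrow> F x - e * k x \<le> F (x + e *\<^sub>R y)"
  shows "ennreal (e * (n * w * max 0 (root n (measure lborel {x. t \<le> F x}) - e * w) ^ (n - 1)))
    \<le> emeasure lborel {x. F x - e * k x \<le> t \<and> t \<le> F x}"
proof -
  define A where "A = {x. t < F x - e * k x}"
  define S where "S = {x. t \<le> F x}"
  define a where "a = root n (measure lborel S)"
  \<comment> \<open>The cut at 0 covers an empty \<open>A\<close>, for which Brunn-Minkowski says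
    nothing and \<open>a - e * w\<close> may be negative.\<close>
  define b where "b = max 0 (a - e * w)"
  have n0: "0 < n" using n by simp
  have [measurable]: "F \<in> borel_measurable borel" "k \<in> borel_measurable borel"
    using F k by (auto intro: borel_measurable_continuous_onI)
  have "open A"
    unfolding A_def using F k by (intro open_Collect_less continuous_intros)
  have le: "F x - e * k x \<le> F x" for x
    using k \<open>0 < e\<close> by simp
  have AS: "A \<subseteq> S" "S \<subseteq> {x. 0 < F x}"
    using le \<open>0 < t\<close> by (auto simp: A_def S_def) (smt (verit) le)
  then have bd: "bounded A" "bounded S" using F(2) bounded_subset by blast+
  have S: "S \<in> fmeasurable lborel"
    using bd by (intro bounded_fmeasurable_lborel) (auto simp: S_def)
  have A: "A \<in> fmeasurable lborel"
    using bd by (intro bounded_fmeasurable_lborel) (auto simp: A_def)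
  have w: "0 \<le> w" unfolding w_def by (simp add: real_root_ge_zero)
  have "measure lborel A \<le> b ^ n"
  proof (cases "A = {}")
    case False
    have "(root n (measure lborel A) + e * w) ^ n \<le> measure lborel S"
      unfolding n_def w_def
    proof (rule brunn_minkowski_convex_dilation[OF \<open>open A\<close> bd(1) False B \<open>0 < e\<close> S])
      fix x y assume "x \<in> A" "y \<in> B"
      then show "x + e *\<^sub>R y \<in> S"
        using descent[of x y] AS by (auto simp: A_def S_def)
    qed
    then have "root n ((root n (measure lborel A) + e * w) ^ n) \<le> a"
      unfolding a_def using n0 by (intro real_root_le_mono)
    then have "root n (measure lborel A) \<le> b"
      using n0 w \<open>0 < e\<close> by (simp add: real_root_power_cancel b_def)
    then have "root n (measure lborel A) ^ n \<le> b ^ n"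
      using n0 by (intro power_mono) auto
    then show ?thesis using n0 by simp
  qed (simp add: b_def)
  moreover have "e * (n * w * b ^ (n - 1)) \<le> a ^ n - b ^ n"
  proof (cases "b = 0")
    case True
    then show ?thesis using n by (auto simp: a_def power_0_left)
  next
    case False
    then have "e * w = a - b" by (auto simp: b_def max_def split: if_splits)
    then have "e * (n * w * b ^ (n - 1)) = n * b ^ (n - 1) * (a - b)"
      by (metis (no_types, lifting) mult.assoc mult.commute)
    also have "\<dots> \<le> a ^ n - b ^ n"
      using n by (intro power_diff_ge_tangent) (auto simp: a_def b_def)
    finally show ?thesis .
  qed
  moreover have "a ^ n = measure lborel S" using n0 by (simp add: a_def)
  ultimately have "e * (n * w * b ^ (n - 1)) \<le> measure lborel S - measure lborel A" by simp
  also have "\<dots> = measure lborel (S - A)"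
    using S A AS by (subst measurable_measure_Diff) (auto dest: fmeasurableD)
  finally have "ennreal (e * (n * w * b ^ (n - 1))) \<le> ennreal (measure lborel (S - A))"
    by (rule ennreal_leI)
  also have "\<dots> = emeasure lborel (S - A)"
    using S A by (intro emeasure_eq_measure2[symmetric] fmeasurable_Diff) (auto dest: fmeasurableD)
  also have "S - A = {x. F x - e * k x \<le> t \<and> t \<le> F x}"
    by (auto simp: S_def A_def)
  finally show ?thesis by (simp add: b_def a_def S_def)
qed

text \<open>The condition \<open>0 < F x\<close> keeps the set bounded also for
  \<open>t \<le> 0\<close>. Without it the set could have infinite volume, to which
  \<open>measure\<close> assigns 0, and monotonicity on the whole line would fail.\<close>

lemma measure_superlevel_antimono:
  fixes F :: "'a::euclidean_space \<Rightarrow> real"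
  assumes F: "continuous_on UNIV F" "bounded {x. 0 < F x}"
  shows "antimono (\<lambda>t. measure lborel {x. 0 < F x \<and> t \<le> F x})"
proof (rule antimonoI)
  have [measurable]: "F \<in> borel_measurable borel"
    using F by (auto intro: borel_measurable_continuous_onI)
  fix s t :: real assume "s \<le> t"
  then show "measure lborel {x. 0 < F x \<and> t \<le> F x} \<le> measure lborel {x. 0 < F x \<and> s \<le> F x}"
    using F(2) by (intro measure_mono_fmeasurable bounded_fmeasurable_lborel) (auto elim: bounded_subset)
qed

lemma borel_measurable_antimono:
  fixes m :: "real \<Rightarrow> real"
  assumes "antimono m"
  shows "m \<in> borel_measurable borel"
proof -
  have "(\<lambda>t. - m t) \<in> borel_measurable borel"
    using assms by (intro borel_measurable_mono) (auto simp: monotone_def)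
  then show ?thesis by simp
qed

text \<open>The strip estimate is integrated against \<psi> and the order of integration exchanged.
  For fixed \<open>x\<close> the admissible levels form an interval of length at most
  \<open>e * k x\<close> below \<open>min (F x) T\<close>, on which the increasing \<psi> is largest
  at the upper end. Both sides then carry the factor \<open>e\<close>, which cancels.\<close>

lemma weighted_isoperimetric_step:
  fixes F k :: "'a::euclidean_space \<Rightarrow> real" and B :: "'a set" and \<psi> :: "real \<Rightarrow> real"
  defines "n \<equiv> DIM('a)"
  defines "w \<equiv> root n (measure lebesgue B)"
  assumes n: "2 \<le> n"
    and F: "continuous_on UNIV F" "bounded {x. 0 < F x}"
    and k: "continuous_on UNIV k" "\<And>x. 0 \<le> k x"
    and B: "convex B" "bounded B" "0 < measure lebesgue B"
    and "0 < e" "0 < T"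
    and descent: "\<And>x y. 0 < F x \<Longrightarrow> y \<in> B \<Longrightarrow> F x - e * k x \<le> F (x + e *\<^sub>R y)"
    and \<psi>[measurable]: "\<psi> \<in> borel_measurable borel"
    and mono: "\<And>s t. 0 < s \<Longrightarrow> s \<le> t \<Longrightarrow> t \<le> T \<Longrightarrow> \<psi> s \<le> \<psi> t"
    and nonneg: "\<And>s. 0 \<le> \<psi> s"
  shows "(\<integral>\<^sup>+t\<in>{0<..<T}. ennreal (\<psi> t * (n * w * max 0 (root n (measure lborel {x. 0 < F x \<and> t \<le> F x}) - e * w) ^ (n - 1))) \<partial>lborel)
    \<le> (\<integral>\<^sup>+x\<in>{x. 0 < F x}. ennreal (\<psi> (min (F x) T) * k x) \<partial>lborel)"
proof -
  have [measurable]: "F \<in> borel_measurable borel" "k \<in> borel_measurable borel"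
    using F k by (auto intro: borel_measurable_continuous_onI)
  let ?c = "\<lambda>t. n * w * max 0 (root n (measure lborel {x. 0 < F x \<and> t \<le> F x}) - e * w) ^ (n - 1)"
  let ?G = "\<lambda>x t. ennreal (\<psi> t) * indicator {0<..<T} t * indicator {t. F x - e * k x \<le> t \<and> t \<le> F x} t"
  have [measurable]: "(\<lambda>t. measure lborel {x. 0 < F x \<and> t \<le> F x}) \<in> borel_measurable borel"
    by (intro borel_measurable_antimono measure_superlevel_antimono F)
  have w: "0 \<le> w" unfolding w_def by (simp add: real_root_ge_zero)
  have c0: "0 \<le> ?c t" for t using w by simp
  have "ennreal e * (\<integral>\<^sup>+t\<in>{0<..<T}. ennreal (\<psi> t * ?c t) \<partial>lborel)
      = (\<integral>\<^sup>+t. ennreal e * (ennreal (\<psi> t * ?c t) * indicator {0<..<T} t) \<partial>lborel)"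
    by (intro nn_integral_cmult[symmetric]) measurable
  also have "\<dots> \<le> (\<integral>\<^sup>+t. (\<integral>\<^sup>+x. ?G x t \<partial>lborel) \<partial>lborel)"
  proof (rule nn_integral_mono)
    fix t
    show "ennreal e * (ennreal (\<psi> t * ?c t) * indicator {0<..<T} t) \<le> (\<integral>\<^sup>+x. ?G x t \<partial>lborel)"
    proof (cases "0 < t \<and> t < T")
      case True
      then have eq: "{x. 0 < F x \<and> t \<le> F x} = {x. t \<le> F x}" by auto
      have "ennreal e * (ennreal (\<psi> t * ?c t) * indicator {0<..<T} t) = ennreal (\<psi> t) * ennreal (e * ?c t)"
        using True c0[of t] nonneg[of t] \<open>0 < e\<close> by (simp flip: ennreal_mult' add: mult_ac)
      also have "\<dots> \<le> ennreal (\<psi> t) * emeasure lborel {x. F x - e * k x \<le> t \<and> t \<le> F x}"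
        unfolding eq n_def w_def
        using measure_superlevel_strip_ge[OF n[unfolded n_def] F k B \<open>0 < e\<close> _ descent, of t] True
        by (intro mult_left_mono) auto
      also have "\<dots> = (\<integral>\<^sup>+x. ennreal (\<psi> t) * indicator {x. F x - e * k x \<le> t \<and> t \<le> F x} x \<partial>lborel)"
        by (subst nn_integral_cmult_indicator) auto
      also have "\<dots> = (\<integral>\<^sup>+x. ?G x t \<partial>lborel)"
        using True by (intro nn_integral_cong) (auto simp: indicator_def)
      finally show ?thesis .
    qed simp
  qed
  also have "\<dots> = (\<integral>\<^sup>+x. (\<integral>\<^sup>+t. ?G x t \<partial>lborel) \<partial>lborel)"
    by (rule lborel_pair.Fubini') measurable
  also have "\<dots> \<le> (\<integral>\<^sup>+x. ennreal e * (ennreal (\<psi> (min (F x) T) * k x) * indicator {x. 0 < F x} x) \<partial>lborel)"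
  proof (rule nn_integral_mono)
    fix x
    show "(\<integral>\<^sup>+t. ?G x t \<partial>lborel) \<le> ennreal e * (ennreal (\<psi> (min (F x) T) * k x) * indicator {x. 0 < F x} x)"
    proof (cases "0 < F x")
      case True
      have "(\<integral>\<^sup>+t. ?G x t \<partial>lborel) \<le> (\<integral>\<^sup>+t. ennreal (\<psi> (min (F x) T)) * indicator {F x - e * k x..F x} t \<partial>lborel)"
        using mono by (intro nn_integral_mono) (auto simp: indicator_def intro!: ennreal_leI)
      also have "\<dots> = ennreal (\<psi> (min (F x) T)) * ennreal (e * k x)"
        using k(2)[of x] \<open>0 < e\<close> by (subst nn_integral_cmult_indicator) auto
      also have "\<dots> = ennreal e * (ennreal (\<psi> (min (F x) T) * k x) * indicator {x. 0 < F x} x)"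
        using True nonneg[of "min (F x) T"] k(2)[of x] \<open>0 < e\<close> by (simp flip: ennreal_mult' add: mult_ac)
      finally show ?thesis .
    next
      case False
      then have "(\<integral>\<^sup>+t. ?G x t \<partial>lborel) = (\<integral>\<^sup>+(t::real). 0 \<partial>lborel)"
        by (intro nn_integral_cong) (auto simp: indicator_def)
      then show ?thesis by simp
    qed
  qed
  also have "\<dots> = ennreal e * (\<integral>\<^sup>+x\<in>{x. 0 < F x}. ennreal (\<psi> (min (F x) T) * k x) \<partial>lborel)"
    by (intro nn_integral_cmult) auto
  finally show ?thesis
    using \<open>0 < e\<close> by (simp add: ennreal_mult_le_mult_iff)
qed


text \<open>Two limits in a fixed order: \<eta> is chosen and only afterwards \<open>e\<close> tends
  to 0, because the admissible \<open>e\<close> depend on \<eta>. Fatou's lemma handles the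
  left-hand side; the excess \<eta> on the right costs at most \<psi>(T) times the finite volume of
  \<open>{x. 0 < F x}\<close> times \<eta>.\<close>

lemma weighted_isoperimetric:
  fixes F h :: "'a::euclidean_space \<Rightarrow> real" and B :: "'a set" and \<psi> :: "real \<Rightarrow> real"
  defines "n \<equiv> DIM('a)"
  defines "w \<equiv> root n (measure lebesgue B)"
  assumes n: "2 \<le> n"
    and F: "continuous_on UNIV F" "bounded {x. 0 < F x}"
    and h: "continuous_on UNIV h" "\<And>x. 0 \<le> h x"
    and B: "convex B" "bounded B" "0 < measure lebesgue B"
    and "0 < T"
    and descent: "\<And>\<eta>. 0 < \<eta> \<Longrightarrow> \<exists>\<delta>>0. \<forall>e. 0 < e \<and> e < \<delta> \<longrightarrow>
      (\<forall>x y. 0 < F x \<longrightarrow> y \<in> B \<longrightarrow> F x - e * (h x + \<eta>) \<le> F (x + e *\<^sub>R y))"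
    and \<psi>[measurable]: "\<psi> \<in> borel_measurable borel"
    and mono: "\<And>s t. 0 < s \<Longrightarrow> s \<le> t \<Longrightarrow> t \<le> T \<Longrightarrow> \<psi> s \<le> \<psi> t"
    and nonneg: "\<And>s. 0 \<le> \<psi> s"
  shows "(\<integral>\<^sup>+t\<in>{0<..<T}. ennreal (\<psi> t * (n * w * root n (measure lborel {x. 0 < F x \<and> t \<le> F x}) ^ (n - 1))) \<partial>lborel)
    \<le> (\<integral>\<^sup>+x\<in>{x. 0 < F x}. ennreal (\<psi> (min (F x) T) * h x) \<partial>lborel)"
proof (rule ennreal_le_epsilon)
  fix \<epsilon> :: real assume "0 < \<epsilon>"
  have [measurable]: "F \<in> borel_measurable borel" "h \<in> borel_measurable borel"
    using F h by (auto intro: borel_measurable_continuous_onI)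
  define a where "a t = root n (measure lborel {x. 0 < F x \<and> t \<le> F x})" for t
  have [measurable]: "a \<in> borel_measurable borel"
    unfolding a_def
    using borel_measurable_antimono[OF measure_superlevel_antimono[OF F]] by measurable
  have a0: "0 \<le> a t" for t by (simp add: a_def real_root_ge_zero)
  define V where "V = measure lborel {x. 0 < F x}"
  have V: "emeasure lborel {x. 0 < F x} = ennreal V"
    using F(2) unfolding V_def by (intro emeasure_eq_measure2 bounded_fmeasurable_lborel) auto
  \<comment> \<open>Chosen so that the total excess \<open>\<psi> T * V * \<eta>\<close> is at most
    \<epsilon>; the added 1 keeps the denominator positive when the product vanishes.\<close>
  define \<eta> where "\<eta> = \<epsilon> / (\<psi> T * V + 1)"
  have pos: "0 < \<psi> T * V + 1" using nonneg by (intro add_nonneg_pos mult_nonneg_nonneg) (auto simp: V_def)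
  then have \<eta>: "0 < \<eta>" using \<open>0 < \<epsilon>\<close> by (simp add: \<eta>_def)
  obtain \<delta> where \<delta>: "0 < \<delta>" "\<And>e x y. 0 < e \<Longrightarrow> e < \<delta> \<Longrightarrow> 0 < F x \<Longrightarrow> y \<in> B \<Longrightarrow> F x - e * (h x + \<eta>) \<le> F (x + e *\<^sub>R y)"
    using descent[OF \<eta>] by blast
  \<comment> \<open>The denominator starts at 2, so that \<open>e i\<close> is strictly below
    \<delta> from the start.\<close>
  define e where "e i = \<delta> / real (Suc (Suc i))" for i
  have e: "0 < e i" "e i < \<delta>" for i
    using \<delta> by (auto simp: e_def field_simps intro!: add_pos_nonneg)
  have e_lim: "e \<longlonglongrightarrow> 0"
    unfolding e_def using LIMSEQ_Suc[OF LIMSEQ_Suc[OF lim_const_over_n[of \<delta>]]] by simp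
  let ?u = "\<lambda>i t. ennreal (\<psi> t * (n * w * max 0 (a t - e i * w) ^ (n - 1))) * indicator {0<..<T} t"
  let ?R = "\<lambda>k. \<integral>\<^sup>+x\<in>{x. 0 < F x}. ennreal (\<psi> (min (F x) T) * k x) \<partial>lborel"
  have step: "(\<integral>\<^sup>+t. ?u i t \<partial>lborel) \<le> ?R (\<lambda>x. h x + \<eta>)" for i
    unfolding a_def n_def w_def
    by (rule weighted_isoperimetric_step[OF n[unfolded n_def] F _ _ B e(1) \<open>0 < T\<close> \<delta>(2)[OF e] \<psi> mono nonneg])
      (use h \<eta> in \<open>auto intro!: continuous_intros add_nonneg_nonneg\<close>)
  have lim: "(\<lambda>i. ?u i t) \<longlonglongrightarrow> ennreal (\<psi> t * (n * w * a t ^ (n - 1))) * indicator {0<..<T} t" for t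
  proof -
    have "(\<lambda>i. \<psi> t * (n * w * max 0 (a t - e i * w) ^ (n - 1))) \<longlonglongrightarrow> \<psi> t * (n * w * max 0 (a t - 0 * w) ^ (n - 1))"
      by (intro tendsto_intros e_lim)
    then have "(\<lambda>i. ennreal (\<psi> t * (n * w * max 0 (a t - e i * w) ^ (n - 1)))) \<longlonglongrightarrow> ennreal (\<psi> t * (n * w * a t ^ (n - 1)))"
      using a0[of t] by (intro tendsto_ennrealI) simp
    then show ?thesis by (cases "t \<in> {0<..<T}") auto
  qed
  have "(\<integral>\<^sup>+t\<in>{0<..<T}. ennreal (\<psi> t * (n * w * a t ^ (n - 1))) \<partial>lborel) = (\<integral>\<^sup>+t. liminf (\<lambda>i. ?u i t) \<partial>lborel)"
    using lim_imp_Liminf[OF _ lim] by simp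
  also have "\<dots> \<le> liminf (\<lambda>i. \<integral>\<^sup>+t. ?u i t \<partial>lborel)"
    by (intro nn_integral_liminf) measurable
  also have "\<dots> \<le> ?R (\<lambda>x. h x + \<eta>)"
    using step by (intro Liminf_le) auto
  also have "\<dots> \<le> (\<integral>\<^sup>+x. ennreal (\<psi> (min (F x) T) * h x) * indicator {x. 0 < F x} x
      + ennreal (\<psi> T * \<eta>) * indicator {x. 0 < F x} x \<partial>lborel)"
  proof (rule nn_integral_mono)
    fix x
    show "ennreal (\<psi> (min (F x) T) * (h x + \<eta>)) * indicator {x. 0 < F x} x
      \<le> ennreal (\<psi> (min (F x) T) * h x) * indicator {x. 0 < F x} x + ennreal (\<psi> T * \<eta>) * indicator {x. 0 < F x} x"
    proof (cases "0 < F x")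
      case True
      have "\<psi> (min (F x) T) \<le> \<psi> T" using True \<open>0 < T\<close> by (intro mono) auto
      then have "\<psi> (min (F x) T) * (h x + \<eta>) \<le> \<psi> (min (F x) T) * h x + \<psi> T * \<eta>"
        using \<eta> by (simp add: distrib_left)
      then show ?thesis
        using True nonneg h(2)[of x] \<eta> by (simp flip: ennreal_plus add: ennreal_leI)
    qed simp
  qed
  also have "\<dots> = ?R h + ennreal (\<psi> T * \<eta>) * ennreal V"
    by (subst nn_integral_add) (auto simp: nn_integral_cmult_indicator V)
  also have "ennreal (\<psi> T * \<eta>) * ennreal V = ennreal (\<psi> T * V * \<eta>)"
    using nonneg \<eta> by (simp flip: ennreal_mult add: V_def mult_ac)
  also have "\<dots> \<le> ennreal \<epsilon>"
  proof (rule ennreal_leI)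
    have "\<psi> T * V * \<eta> \<le> (\<psi> T * V + 1) * \<eta>" using \<eta> by simp
    also have "\<dots> = \<epsilon>" using pos by (simp add: \<eta>_def)
    finally show "\<psi> T * V * \<eta> \<le> \<epsilon>" .
  qed
  finally show "(\<integral>\<^sup>+t\<in>{0<..<T}. ennreal (\<psi> t * (n * w * root n (measure lborel {x. 0 < F x \<and> t \<le> F x}) ^ (n - 1))) \<partial>lborel)
    \<le> ?R h + ennreal \<epsilon>" by (simp add: a_def)
qed

section \<open>Integrals of the measure of superlevel sets\<close>

lemma (in finite_measure) antimono_measure_ge:
  fixes X :: "'a \<Rightarrow> real"
  assumes [measurable]: "X \<in> borel_measurable M"
  shows "antimono (\<lambda>t. measure M {x \<in> space M. t \<le> X x})"
  by (intro antimonoI finite_measure_mono) auto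

text \<open>If \<open>X\<close> has no atoms, \<open>m (X x)\<close> is uniformly distributed.  With atoms the bound survives only
  because \<open>m\<close> is defined by \<open>t \<le> X x\<close> and not by \<open>t < X x\<close>.\<close>

lemma (in finite_measure) measure_measure_ge_le:
  fixes X :: "'a \<Rightarrow> real"
  defines "m \<equiv> \<lambda>t. measure M {x \<in> space M. t \<le> X x}"
  assumes X[measurable]: "X \<in> borel_measurable M" and nonneg: "\<And>x. x \<in> space M \<Longrightarrow> 0 \<le> X x"
    and "0 \<le> r"
  shows "measure M {x \<in> space M. m (X x) \<le> r} \<le> r"
proof -
  have m: "m t \<le> m s" if "s \<le> t" for s t
    using antimono_measure_ge[OF X] that unfolding m_def monotone_def by blast
  \<comment> \<open>\<open>U\<close> is an upward closed set of nonnegative levels, as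
    \<open>m\<close> decreases, and \<open>?E\<close> consists of the points with
    \<open>X x \<in> U\<close>. If the infimum belongs to \<open>U\<close>, then \<open>?E\<close>
    lies in that superlevel set, whose measure is at most \<open>r\<close>. Otherwise
    \<open>X x\<close> exceeds the infimum strictly and \<open>?E\<close> is covered by increasing
    superlevel sets with levels in \<open>U\<close>.\<close>
  define U where "U = {s. 0 \<le> s \<and> m s \<le> r}"
  let ?E = "{x \<in> space M. m (X x) \<le> r}"
  have E: "X x \<in> U" if "x \<in> ?E" for x using that nonneg by (auto simp: U_def)
  have bdd: "bdd_below U" by (auto simp: U_def bdd_below_def)
  consider "U = {}" | "Inf U \<in> U" | "U \<noteq> {}" "Inf U \<notin> U" by blast
  then show ?thesis
  proof cases
    case 1
    then have "?E = {}" using E by blast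
    then show ?thesis using \<open>0 \<le> r\<close> by (metis measure_empty)
  next
    case 2
    have "?E \<subseteq> {x \<in> space M. Inf U \<le> X x}"
      using cInf_lower[OF E bdd] by auto
    then have "measure M ?E \<le> m (Inf U)"
      unfolding m_def by (intro finite_measure_mono) auto
    also have "\<dots> \<le> r" using 2 by (simp add: U_def)
    finally show ?thesis .
  next
    case 3
    define A where "A k = {x \<in> space M. Inf U + inverse (real (Suc k)) \<le> X x}" for k
    have [measurable]: "A k \<in> sets M" for k unfolding A_def by measurable
    have A: "measure M (A k) \<le> r" for k
    proof -
      obtain u where "u \<in> U" "u < Inf U + inverse (real (Suc k))"
        using 3(1) bdd cInf_lessD[of U "Inf U + inverse (real (Suc k))"] by auto
      then have "m (Inf U + inverse (real (Suc k))) \<le> m u" "m u \<le> r"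
        by (auto intro: m simp: U_def)
      then show ?thesis by (simp add: A_def m_def)
    qed
    have "incseq A"
    proof (rule monoI)
      fix i j :: nat assume "i \<le> j"
      then have "inverse (real (Suc j)) \<le> inverse (real (Suc i))"
        by (intro le_imp_inverse_le) auto
      then have "Inf U + inverse (real (Suc j)) \<le> Inf U + inverse (real (Suc i))"
        by (rule add_left_mono)
      then show "A i \<subseteq> A j" unfolding A_def using order_trans by blast
    qed
    then have "(\<lambda>k. measure M (A k)) \<longlonglongrightarrow> measure M (\<Union>k. A k)"
      by (intro Lim_measure_incseq) auto
    then have "measure M (\<Union>k. A k) \<le> r"
      using A by (intro LIMSEQ_le_const2) auto
    moreover have "?E \<subseteq> (\<Union>k. A k)"
    proof
      fix x assume x: "x \<in> ?E"
      then have "Inf U \<le> X x" "X x \<noteq> Inf U"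
        using cInf_lower[OF E bdd, of x] E[OF x] 3 by auto
      then have "0 < X x - Inf U" by simp
      then obtain k where "inverse (real (Suc k)) < X x - Inf U"
        using reals_Archimedean by blast
      then have "x \<in> A k" using x by (auto simp: A_def)
      then show "x \<in> (\<Union>k. A k)" by blast
    qed
    then have "measure M ?E \<le> measure M (\<Union>k. A k)"
      by (intro finite_measure_mono) auto
    ultimately show ?thesis by simp
  qed
qed

text \<open>Layer-cake formula for a negative power: \<open>c powr - \<alpha>\<close> becomes a
  superposition of the conditions \<open>c \<le> r\<close>. With \<open>c = m (X x)\<close> these
  are the events bounded by \<open>measure_measure_ge_le\<close>.\<close>

lemma nn_integral_powr_atLeast:
  fixes c \<alpha> :: real
  assumes "0 < c" "0 < \<alpha>"
  shows "(\<integral>\<^sup>+r. ennreal (\<alpha> * r powr (- \<alpha> - 1)) * indicator {c..} r \<partial>lborel) = ennreal (c powr - \<alpha>)"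
proof -
  have "((\<lambda>r. \<alpha> * r powr (- \<alpha> - 1)) has_integral \<alpha> * (- (c powr (- \<alpha> - 1 + 1)) / (- \<alpha> - 1 + 1))) {c..}"
    using assms by (intro has_integral_mult_right has_integral_powr_to_inf) auto
  then have "((\<lambda>r. \<alpha> * r powr (- \<alpha> - 1)) has_integral c powr - \<alpha>) {c..}"
    using assms by simp
  from nn_integral_has_integral_lebesgue[OF _ this] assms show ?thesis
    by (simp add: mult.commute ennreal_mult' flip: ennreal_indicator)
qed

lemma nn_integral_powr_from_0:
  fixes c a :: real
  assumes "0 \<le> c" "0 < a"
  shows "(\<integral>\<^sup>+r. ennreal (a * r powr (a - 1)) * indicator {0..c} r \<partial>lborel) = ennreal (c powr a)"
proof -
  have "((\<lambda>r. a * r powr (a - 1)) has_integral a * (c powr (a - 1 + 1) / (a - 1 + 1))) {0..c}"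
    using assms by (intro has_integral_mult_right has_integral_powr_from_0) auto
  then have "((\<lambda>r. a * r powr (a - 1)) has_integral c powr a) {0..c}"
    using assms by simp
  from nn_integral_has_integral_lebesgue[OF _ this] assms show ?thesis
    by (simp add: mult.commute ennreal_mult' flip: ennreal_indicator)
qed

text \<open>If \<open>m (X x)\<close> were uniformly distributed, the left-hand side would be the
  integral of r^(-\<alpha>) over (0, m(t)), which is the right-hand side. The one-sided bound on the
  distribution suffices because the negative power is decreasing.\<close>

lemma (in finite_measure) nn_integral_measure_ge_powr_le:
  fixes X :: "'a \<Rightarrow> real"
  defines "m \<equiv> \<lambda>t. measure M {x \<in> space M. t \<le> X x}"
  assumes X[measurable]: "X \<in> borel_measurable M" and nonneg: "\<And>x. x \<in> space M \<Longrightarrow> 0 \<le> X x"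
    and \<alpha>: "0 < \<alpha>" "\<alpha> < 1"
  shows "(\<integral>\<^sup>+x. ennreal (m (X x) powr - \<alpha>) * indicator {x. t \<le> X x} x \<partial>M)
    \<le> ennreal (m t powr (1 - \<alpha>) / (1 - \<alpha>))"
proof -
  interpret P: pair_sigma_finite M lborel ..
  have m: "m t \<le> m s" if "s \<le> t" for s t
    using antimono_measure_ge[OF X] that unfolding m_def monotone_def by blast
  have [measurable]: "m \<in> borel_measurable borel"
    unfolding m_def by (intro borel_measurable_antimono antimono_measure_ge X)
  have m0: "0 \<le> m s" for s by (simp add: m_def)
  let ?k = "\<lambda>r. ennreal (\<alpha> * r powr (- \<alpha> - 1))"
  let ?G = "\<lambda>x r. ?k r * indicator {0<..} r * indicator {x. t \<le> X x} x * indicator {x. m (X x) \<le> r} x"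
  have "(\<integral>\<^sup>+x. ennreal (m (X x) powr - \<alpha>) * indicator {x. t \<le> X x} x \<partial>M)
      \<le> (\<integral>\<^sup>+x. \<integral>\<^sup>+r. ?G x r \<partial>lborel \<partial>M)"
  proof (rule nn_integral_mono)
    fix x
    show "ennreal (m (X x) powr - \<alpha>) * indicator {x. t \<le> X x} x \<le> (\<integral>\<^sup>+r. ?G x r \<partial>lborel)"
    \<comment> \<open>Where \<open>m (X x) = 0\<close> the convention \<open>0 powr a = 0\<close>
      makes the left-hand side vanish, although the integral over \<open>r\<close> diverges
      there.\<close>
    proof (cases "t \<le> X x \<and> m (X x) \<noteq> 0")
      case True
      then have pos: "0 < m (X x)" using m0[of "X x"] by linarith
      have "ennreal (m (X x) powr - \<alpha>) = (\<integral>\<^sup>+r. ?k r * indicator {m (X x)..} r \<partial>lborel)"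
        using nn_integral_powr_atLeast[OF pos \<alpha>(1)] by simp
      also have "\<dots> = (\<integral>\<^sup>+r. ?G x r \<partial>lborel)"
        using True pos by (intro nn_integral_cong) (auto simp: indicator_def)
      finally show ?thesis using True by simp
    qed auto
  qed
  also have "\<dots> = (\<integral>\<^sup>+r. \<integral>\<^sup>+x. ?G x r \<partial>M \<partial>lborel)"
    by (rule P.Fubini'[symmetric]) measurable
  also have "\<dots> \<le> (\<integral>\<^sup>+r. ?k r * ennreal r * indicator {0..m t} r + ?k r * indicator {m t..} r * ennreal (m t) \<partial>lborel)"
  proof (rule nn_integral_mono)
    fix r :: real
    show "(\<integral>\<^sup>+x. ?G x r \<partial>M) \<le> ?k r * ennreal r * indicator {0..m t} r + ?k r * indicator {m t..} r * ennreal (m t)"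
    proof (cases "0 < r")
      case True
      \<comment> \<open>Two bounds compete: \<open>r\<close> from the distribution of
        \<open>m (X x)\<close> and \<open>m t\<close> from the condition \<open>t \<le> X x\<close>.
        They cross at \<open>r = m t\<close>, which splits the integral into a power from 0 and a
        tail.\<close>
      let ?S = "{x \<in> space M. t \<le> X x \<and> m (X x) \<le> r}"
      have "measure M ?S \<le> m t"
        unfolding m_def by (intro finite_measure_mono) auto
      moreover have "measure M ?S \<le> measure M {x \<in> space M. m (X x) \<le> r}"
        by (intro finite_measure_mono) auto
      moreover have "\<dots> \<le> r"
        using measure_measure_ge_le[OF X nonneg] True by (simp add: m_def)
      ultimately have S: "emeasure M ?S \<le> ennreal (min (m t) r)"
        unfolding emeasure_eq_measure by (intro ennreal_leI) simp
      have "(\<integral>\<^sup>+x. ?G x r \<partial>M) = (\<integral>\<^sup>+x. ?k r * indicator ?S x \<partial>M)"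
        using True by (intro nn_integral_cong) (auto simp: indicator_def)
      also have "\<dots> = ?k r * emeasure M ?S"
        by (intro nn_integral_cmult_indicator) measurable
      also have "\<dots> \<le> ?k r * ennreal (min (m t) r)"
        by (intro mult_left_mono S) simp
      also have "\<dots> \<le> ?k r * ennreal r * indicator {0..m t} r + ?k r * indicator {m t..} r * ennreal (m t)"
        using True by (auto simp: indicator_def min_def)
      finally show ?thesis .
    qed simp
  qed
  also have "\<dots> = (\<integral>\<^sup>+r. ?k r * ennreal r * indicator {0..m t} r \<partial>lborel)
      + (\<integral>\<^sup>+r. ?k r * indicator {m t..} r \<partial>lborel) * ennreal (m t)"
    by (simp add: nn_integral_add nn_integral_multc)
  also have "(\<integral>\<^sup>+r. ?k r * ennreal r * indicator {0..m t} r \<partial>lborel)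
      = ennreal (\<alpha> / (1 - \<alpha>)) * (\<integral>\<^sup>+r. ennreal ((1 - \<alpha>) * r powr ((1 - \<alpha>) - 1)) * indicator {0..m t} r \<partial>lborel)"
  proof (subst nn_integral_cmult[symmetric])
    have *: "?k r * ennreal r = ennreal (\<alpha> / (1 - \<alpha>)) * ennreal ((1 - \<alpha>) * r powr ((1 - \<alpha>) - 1))" if "0 \<le> r" for r
    proof -
      have "r powr (- \<alpha> - 1) * r = r powr - \<alpha>"
        using that powr_add[of r "- \<alpha> - 1" 1] by (cases "r = 0") auto
      then have "?k r * ennreal r = ennreal (\<alpha> * r powr - \<alpha>)"
        using \<alpha> that by (simp flip: ennreal_mult add: mult.assoc)
      also have "\<alpha> * r powr - \<alpha> = \<alpha> / (1 - \<alpha>) * ((1 - \<alpha>) * r powr ((1 - \<alpha>) - 1))"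
        using \<alpha> by simp
      also have "ennreal \<dots> = ennreal (\<alpha> / (1 - \<alpha>)) * ennreal ((1 - \<alpha>) * r powr ((1 - \<alpha>) - 1))"
        using \<alpha> by (intro ennreal_mult) auto
      finally show ?thesis .
    qed
    show "(\<integral>\<^sup>+r. ?k r * ennreal r * indicator {0..m t} r \<partial>lborel)
      = (\<integral>\<^sup>+r. ennreal (\<alpha> / (1 - \<alpha>)) * (ennreal ((1 - \<alpha>) * r powr ((1 - \<alpha>) - 1)) * indicator {0..m t} r) \<partial>lborel)"
      using * by (intro nn_integral_cong) (auto simp: indicator_def)
  qed measurable
  also have "\<dots> = ennreal (\<alpha> / (1 - \<alpha>)) * ennreal (m t powr (1 - \<alpha>))"
    using \<alpha> m0 by (subst nn_integral_powr_from_0) auto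
  also have "(\<integral>\<^sup>+r. ?k r * indicator {m t..} r \<partial>lborel) * ennreal (m t) = ennreal (m t powr (1 - \<alpha>))"
  proof (cases "m t = 0")
    case False
    then have pos: "0 < m t" using m0[of t] by linarith
    have "m t powr - \<alpha> * m t = m t powr (1 - \<alpha>)"
      using pos powr_add[of "m t" "- \<alpha>" 1] by simp
    then show ?thesis
      using pos \<alpha> by (subst nn_integral_powr_atLeast) (auto simp flip: ennreal_mult')
  qed simp
  also have "ennreal (\<alpha> / (1 - \<alpha>)) * ennreal (m t powr (1 - \<alpha>)) + ennreal (m t powr (1 - \<alpha>))
      = ennreal (m t powr (1 - \<alpha>) / (1 - \<alpha>))"
    using \<alpha> by (simp flip: ennreal_mult ennreal_plus add: field_simps)
  finally show ?thesis .
qed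

text \<open>Layer-cake formula for \<open>X x powr p\<close> followed by the bound for the remaining
  power over each superlevel set. For \<alpha> = p/d the constant \<open>p / (1 - \<alpha>)\<close>
  is p*.\<close>

lemma (in finite_measure) nn_integral_powr_measure_ge_le:
  fixes X :: "'a \<Rightarrow> real"
  defines "m \<equiv> \<lambda>t. measure M {x \<in> space M. t \<le> X x}"
  assumes X[measurable]: "X \<in> borel_measurable M" and X_bounds: "\<And>x. x \<in> space M \<Longrightarrow> 0 \<le> X x" "\<And>x. x \<in> space M \<Longrightarrow> X x \<le> T"
    and \<alpha>: "0 < \<alpha>" "\<alpha> < 1" and "0 < p"
  shows "(\<integral>\<^sup>+x. ennreal (X x powr p * m (X x) powr - \<alpha>) \<partial>M)
    \<le> ennreal (p / (1 - \<alpha>)) * (\<integral>\<^sup>+t\<in>{0<..<T}. ennreal (t powr (p - 1) * m t powr (1 - \<alpha>)) \<partial>lborel)"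
proof -
  interpret P: pair_sigma_finite M lborel ..
  have [measurable]: "m \<in> borel_measurable borel"
    unfolding m_def by (intro borel_measurable_antimono antimono_measure_ge X)
  let ?G = "\<lambda>x t. ennreal (p * t powr (p - 1)) * indicator {0<..T} t * (ennreal (m (X x) powr - \<alpha>) * indicator {x. t \<le> X x} x)"
  have "(\<integral>\<^sup>+x. ennreal (X x powr p * m (X x) powr - \<alpha>) \<partial>M) = (\<integral>\<^sup>+x. \<integral>\<^sup>+t. ?G x t \<partial>lborel \<partial>M)"
  proof (rule nn_integral_cong)
    fix x assume x: "x \<in> space M"
    have "(\<integral>\<^sup>+t. ?G x t \<partial>lborel)
        = (\<integral>\<^sup>+t. ennreal (p * t powr (p - 1)) * indicator {0..X x} t * ennreal (m (X x) powr - \<alpha>) \<partial>lborel)"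
      using X_bounds[OF x] by (intro nn_integral_cong) (auto simp: indicator_def)
    also have "\<dots> = ennreal (X x powr p) * ennreal (m (X x) powr - \<alpha>)"
      using X_bounds[OF x] \<open>0 < p\<close> by (subst nn_integral_multc) (auto simp: nn_integral_powr_from_0)
    finally show "ennreal (X x powr p * m (X x) powr - \<alpha>) = (\<integral>\<^sup>+t. ?G x t \<partial>lborel)"
      by (simp add: ennreal_mult)
  qed
  also have "\<dots> = (\<integral>\<^sup>+t. \<integral>\<^sup>+x. ?G x t \<partial>M \<partial>lborel)"
    by (rule P.Fubini'[symmetric]) measurable
  also have "\<dots> = (\<integral>\<^sup>+t. ennreal (p * t powr (p - 1)) * indicator {0<..T} t *
      (\<integral>\<^sup>+x. ennreal (m (X x) powr - \<alpha>) * indicator {x. t \<le> X x} x \<partial>M) \<partial>lborel)"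
    by (intro nn_integral_cong nn_integral_cmult) measurable
  also have "\<dots> \<le> (\<integral>\<^sup>+t. ennreal (p * t powr (p - 1)) * indicator {0<..T} t * ennreal (m t powr (1 - \<alpha>) / (1 - \<alpha>)) \<partial>lborel)"
    using nn_integral_measure_ge_powr_le[OF X X_bounds(1) \<alpha>]
    by (intro nn_integral_mono mult_left_mono) (auto simp: m_def)
  also have "\<dots> = (\<integral>\<^sup>+t. ennreal (p / (1 - \<alpha>)) * (ennreal (t powr (p - 1) * m t powr (1 - \<alpha>)) * indicator {0<..T} t) \<partial>lborel)"
    using \<alpha> \<open>0 < p\<close> by (intro nn_integral_cong) (auto simp: indicator_def field_simps simp flip: ennreal_mult)
  also have "\<dots> = (\<integral>\<^sup>+t. ennreal (p / (1 - \<alpha>)) * (ennreal (t powr (p - 1) * m t powr (1 - \<alpha>)) * indicator {0<..<T} t) \<partial>lborel)"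
    using AE_lborel_singleton[of T] by (intro nn_integral_cong_AE) (auto simp: indicator_def)
  also have "\<dots> = ennreal (p / (1 - \<alpha>)) * (\<integral>\<^sup>+t\<in>{0<..<T}. ennreal (t powr (p - 1) * m t powr (1 - \<alpha>)) \<partial>lborel)"
    by (intro nn_integral_cmult) measurable
  finally show ?thesis .
qed

section \<open>Sharp Lorentz--Sobolev inequality\<close>

text \<open>Young's inequality with exponents p and p/(p-1), arranged so that equality holds at
  \<open>a = u\<close>. The case \<open>p = 1\<close> is separate because the conjugate exponent
  degenerates.\<close>

lemma young_powr:
  fixes a u p :: real
  assumes "1 \<le> p" "0 < u" "0 \<le> a"
  shows "u powr (p - 1) * a \<le> a powr p / p + (1 - 1 / p) * u powr p"
proof (cases "p = 1")
  case True
  then show ?thesis using assms by simp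
next
  case False
  then have p: "1 < p" using assms by simp
  let ?q = "p / (p - 1)"
  have "a * u powr (p - 1) \<le> a powr p / p + (u powr (p - 1)) powr ?q / ?q"
    using p assms by (intro Youngs_inequality) (auto simp: field_simps)
  also have "(u powr (p - 1)) powr ?q = u powr p"
    using p by (simp add: powr_powr)
  finally show ?thesis using p by (simp add: field_simps)
qed

text \<open>Cutting the levels at \<open>T\<close> keeps \<open>m\<close> bounded away from \<open>0\<close> and the Lorentz integral finite, so that
  it can be absorbed after Young's inequality.\<close>

lemma lorentz_sobolev_truncated:
  fixes F h :: "'a::euclidean_space \<Rightarrow> real" and B :: "'a set" and p T :: real
  defines "n \<equiv> DIM('a)"
  defines "w \<equiv> root n (measure lebesgue B)"
  defines "m \<equiv> \<lambda>t. measure lborel {x. 0 < F x \<and> t \<le> F x}"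
  defines "\<kappa> \<equiv> (n - p) / p * w"
  assumes n: "2 \<le> n" and p: "1 \<le> p" "p < n"
    and F: "continuous_on UNIV F" "bounded {x. 0 < F x}"
    and h: "continuous_on UNIV h" "\<And>x. 0 \<le> h x"
    and B: "convex B" "bounded B" "0 < measure lebesgue B"
    and T: "0 < T" "0 < m T"
    and descent: "\<And>\<eta>. 0 < \<eta> \<Longrightarrow> \<exists>\<delta>>0. \<forall>e. 0 < e \<and> e < \<delta> \<longrightarrow>
      (\<forall>x y. 0 < F x \<longrightarrow> y \<in> B \<longrightarrow> F x - e * (h x + \<eta>) \<le> F (x + e *\<^sub>R y))"
  shows "ennreal (\<kappa> powr p * (p * n / (n - p))) *
      (\<integral>\<^sup>+t\<in>{0<..<T}. ennreal (t powr (p - 1) * m t powr (1 - p / n)) \<partial>lborel)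
    \<le> (\<integral>\<^sup>+x. ennreal (h x powr p) \<partial>lborel)"
proof -
  have [measurable]: "F \<in> borel_measurable borel" "h \<in> borel_measurable borel"
    using F h by (auto intro: borel_measurable_continuous_onI)
  have m_anti: "antimono m"
    unfolding m_def by (rule measure_superlevel_antimono[OF F])
  have m_le: "m t \<le> m s" if "s \<le> t" for s t
    using m_anti that by (auto simp: monotone_def)
  have [measurable]: "m \<in> borel_measurable borel"
    using m_anti by (rule borel_measurable_antimono)
  have m_pos: "0 < m t" if "t \<le> T" for t using m_le[OF that] T by simp
  have w: "0 < w" using B n by (simp add: w_def)
  have \<kappa>: "0 < \<kappa>" using w p by (simp add: \<kappa>_def)
  define J where "J = (\<integral>\<^sup>+t\<in>{0<..<T}. ennreal (t powr (p - 1) * m t powr (1 - p / n)) \<partial>lborel)"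
  define G where "G = (\<integral>\<^sup>+x. ennreal (h x powr p) \<partial>lborel)"
  define c where "c = p * n / (n - p)"
  have c: "0 < c" using p by (simp add: c_def)
  define \<psi> where "\<psi> t = t powr (p - 1) * m t powr (- (p - 1) / n)" for t
  have [measurable]: "\<psi> \<in> borel_measurable borel" unfolding \<psi>_def by measurable
  let ?P = "{x. 0 < F x}" and ?X = "\<lambda>x. min (F x) T"
  let ?M = "restrict_space lborel ?P"
  have P: "?P \<in> sets lborel" by simp
  have "J \<le> (\<integral>\<^sup>+t. ennreal (T powr (p - 1) * m 0 powr (1 - p / n)) * indicator {0<..<T} t \<partial>lborel)"
    unfolding J_def
  proof (rule nn_integral_mono)
    fix t :: real
    show "ennreal (t powr (p - 1) * m t powr (1 - p / n)) * indicator {0<..<T} t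
      \<le> ennreal (T powr (p - 1) * m 0 powr (1 - p / n)) * indicator {0<..<T} t"
    proof (cases "t \<in> {0<..<T}")
      case True
      then have "t powr (p - 1) * m t powr (1 - p / n) \<le> T powr (p - 1) * m 0 powr (1 - p / n)"
        using p m_le[of 0 t] m_pos[of t] by (intro mult_mono powr_mono2) auto
      then show ?thesis using True by (simp add: ennreal_leI)
    qed simp
  qed
  also have "\<dots> < top"
    using T by (simp add: nn_integral_cmult_indicator ennreal_mult_less_top)
  finally obtain j where j: "J = ennreal j" "0 \<le> j"
    by (cases J rule: ennreal_cases) auto
  have "ennreal (n * w) * J = (\<integral>\<^sup>+t. ennreal (n * w) * (ennreal (t powr (p - 1) * m t powr (1 - p / n)) * indicator {0<..<T} t) \<partial>lborel)"
    unfolding J_def by (intro nn_integral_cmult[symmetric]) measurable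
  also have "\<dots> = (\<integral>\<^sup>+t\<in>{0<..<T}. ennreal (\<psi> t * (n * w * root n (m t) ^ (n - 1))) \<partial>lborel)"
  proof (rule nn_integral_cong)
    fix t :: real
    show "ennreal (n * w) * (ennreal (t powr (p - 1) * m t powr (1 - p / n)) * indicator {0<..<T} t)
      = ennreal (\<psi> t * (n * w * root n (m t) ^ (n - 1))) * indicator {0<..<T} t"
    proof (cases "t \<in> {0<..<T}")
      case True
      then have mt: "0 < m t" using m_pos by simp
      have "root n (m t) ^ (n - 1) = m t powr (real (n - 1) / n)"
        using mt n by (simp add: root_powr_inverse powr_powr flip: powr_realpow)
      moreover have "- (p - 1) / n + real (n - 1) / n = 1 - p / n"
        using n by (simp add: field_simps of_nat_diff)
      ultimately have "m t powr (- (p - 1) / n) * root n (m t) ^ (n - 1) = m t powr (1 - p / n)"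
        by (metis powr_add)
      then have "\<psi> t * (n * w * root n (m t) ^ (n - 1)) = n * w * (t powr (p - 1) * m t powr (1 - p / n))"
        by (simp add: \<psi>_def mult_ac)
      then have "ennreal (\<psi> t * (n * w * root n (m t) ^ (n - 1))) = ennreal (n * w) * ennreal (t powr (p - 1) * m t powr (1 - p / n))"
        using w by (metis ennreal_mult' mult_nonneg_nonneg of_nat_0_le_iff order_less_imp_le)
      then show ?thesis using True by simp
    qed simp
  qed
  also have "\<dots> \<le> (\<integral>\<^sup>+x\<in>?P. ennreal (\<psi> (?X x) * h x) \<partial>lborel)"
    unfolding m_def n_def w_def
  proof (rule weighted_isoperimetric[OF n[unfolded n_def] F h B T(1) descent])
    fix s t assume st: "0 < s" "s \<le> t" "t \<le> T"
    show "\<psi> s \<le> \<psi> t"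
      unfolding \<psi>_def using st p n m_le[of s t] m_pos[of t]
      by (intro mult_mono powr_mono2 powr_mono2') (auto simp: divide_nonpos_nonneg)
  qed (auto simp: \<psi>_def)
  also have "\<dots> \<le> (\<integral>\<^sup>+x. ennreal (\<kappa> powr (1 - p) / p) * ennreal (h x powr p)
      + ennreal (\<kappa> * (1 - 1 / p)) * (ennreal (?X x powr p * m (?X x) powr - (p / n)) * indicator ?P x) \<partial>lborel)"
  proof (rule nn_integral_mono)
    fix x
    show "ennreal (\<psi> (?X x) * h x) * indicator ?P x \<le> ennreal (\<kappa> powr (1 - p) / p) * ennreal (h x powr p)
      + ennreal (\<kappa> * (1 - 1 / p)) * (ennreal (?X x powr p * m (?X x) powr - (p / n)) * indicator ?P x)"
    proof (cases "x \<in> ?P")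
      case True
      define X where "X = ?X x"
      have X: "0 < X" "0 < m X" using True T m_pos[of X] by (auto simp: X_def)
      define u where "u = X * m X powr - (1 / n)"
      have u: "0 < u" using X by (simp add: u_def)
      have "\<psi> X = u powr (p - 1)"
      proof -
        have "- (p - 1) / n = - (1 / n) * (p - 1)" by (simp add: diff_divide_distrib)
        then show ?thesis
          unfolding u_def \<psi>_def using X by (simp only: powr_mult powr_powr powr_ge_zero less_imp_le)
      qed
      moreover have "u powr p = X powr p * m X powr - (p / n)"
        using X by (simp add: u_def powr_mult powr_powr)
      \<comment> \<open>Dividing \<open>h x\<close> by \<kappa> puts the equality case of Young's
        inequality at \<open>h x = \<kappa> * u\<close>, the relation satisfied by the extremal
        profile.\<close>
      moreover have "u powr (p - 1) * (h x / \<kappa>) \<le> (h x / \<kappa>) powr p / p + (1 - 1 / p) * u powr p"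
        using p u h(2)[of x] \<kappa> by (intro young_powr) auto
      then have "\<kappa> * (u powr (p - 1) * (h x / \<kappa>)) \<le> \<kappa> * ((h x / \<kappa>) powr p / p + (1 - 1 / p) * u powr p)"
        using \<kappa> by (intro mult_left_mono) auto
      moreover have "\<kappa> * (h x / \<kappa>) powr p = \<kappa> powr (1 - p) * h x powr p"
        using \<kappa> h(2)[of x] by (simp add: powr_divide powr_diff)
      ultimately have "\<psi> X * h x \<le> \<kappa> powr (1 - p) / p * h x powr p + \<kappa> * (1 - 1 / p) * (X powr p * m X powr - (p / n))"
        using \<kappa> by (simp add: distrib_left mult.assoc)
      then show ?thesis
        using True p \<kappa> unfolding X_def[symmetric]
        by (simp flip: ennreal_mult ennreal_plus add: ennreal_leI)
    qed simp
  qed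
  also have "\<dots> = ennreal (\<kappa> powr (1 - p) / p) * G
      + ennreal (\<kappa> * (1 - 1 / p)) * (\<integral>\<^sup>+x\<in>?P. ennreal (?X x powr p * m (?X x) powr - (p / n)) \<partial>lborel)"
    unfolding G_def by (simp add: nn_integral_add nn_integral_cmult)
  also have "(\<integral>\<^sup>+x\<in>?P. ennreal (?X x powr p * m (?X x) powr - (p / n)) \<partial>lborel) \<le> ennreal c * J"
  proof -
    interpret finite_measure ?M
    proof
      have "emeasure lborel ?P < \<infinity>" using F(2) by (rule emeasure_bounded_finite)
      then show "emeasure ?M (space ?M) \<noteq> \<infinity>"
        by (simp add: space_restrict_space emeasure_restrict_space)
    qed
    \<comment> \<open>Truncating the values at \<open>T\<close> leaves the superlevel sets for
      levels up to \<open>T\<close> unchanged, so the same \<open>m\<close> serves for the truncated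
      function.\<close>
    have mM: "measure ?M {x \<in> space ?M. t \<le> ?X x} = m t" if "t \<le> T" for t
    proof -
      have "{x \<in> space ?M. t \<le> ?X x} = {x. 0 < F x \<and> t \<le> F x}"
        using that by (auto simp: space_restrict_space)
      then show ?thesis unfolding m_def by (subst measure_restrict_space) auto
    qed
    have "(\<integral>\<^sup>+x\<in>?P. ennreal (?X x powr p * m (?X x) powr - (p / n)) \<partial>lborel)
      = (\<integral>\<^sup>+x. ennreal (?X x powr p * m (?X x) powr - (p / n)) \<partial>?M)"
      by (rule nn_integral_restrict_space[symmetric]) simp
    also have "\<dots> = (\<integral>\<^sup>+x. ennreal (?X x powr p * measure ?M {y \<in> space ?M. ?X x \<le> ?X y} powr - (p / n)) \<partial>?M)"
      by (intro nn_integral_cong) (simp only: mM min.cobounded2)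
    also have "\<dots> \<le> ennreal (p / (1 - p / n)) * (\<integral>\<^sup>+t\<in>{0<..<T}. ennreal (t powr (p - 1) * measure ?M {y \<in> space ?M. t \<le> ?X y} powr (1 - p / n)) \<partial>lborel)"
      using T p n by (intro nn_integral_powr_measure_ge_le measurable_restrict_space1)
        (auto simp: space_restrict_space)
    also have "(\<integral>\<^sup>+t\<in>{0<..<T}. ennreal (t powr (p - 1) * measure ?M {y \<in> space ?M. t \<le> ?X y} powr (1 - p / n)) \<partial>lborel) = J"
      unfolding J_def
    proof (rule nn_integral_cong)
      fix t :: real
      show "ennreal (t powr (p - 1) * measure ?M {y \<in> space ?M. t \<le> ?X y} powr (1 - p / n)) * indicator {0<..<T} t
        = ennreal (t powr (p - 1) * m t powr (1 - p / n)) * indicator {0<..<T} t"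
      proof (cases "t \<le> T")
        case True
        then show ?thesis by (simp only: mM)
      qed simp
    qed
    also have "p / (1 - p / n) = c" using p n by (simp add: c_def field_simps)
    finally show ?thesis .
  qed
  finally have main: "ennreal (n * w) * J \<le> ennreal (\<kappa> powr (1 - p) / p) * G + ennreal (\<kappa> * (1 - 1 / p)) * (ennreal c * J)"
    by (auto simp: add_left_mono mult_left_mono)
  \<comment> \<open>This identity fixes the constant: \<open>J\<close> has coefficient
    \<open>\<kappa> * c\<close> on the left and \<open>(1 - 1 / p)\<close> times that on the right,
    so \<open>\<kappa> * c / p\<close> remains after absorption.\<close>
  have nw: "n * w = \<kappa> * c" using p by (simp add: \<kappa>_def c_def)
  show ?thesis
  proof (cases G rule: ennreal_cases)
    case (real g)
    have "ennreal (\<kappa> * c * j) \<le> ennreal (\<kappa> powr (1 - p) / p * g + \<kappa> * (1 - 1 / p) * (c * j))"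
      using main j real \<kappa> p c unfolding nw by (simp flip: ennreal_mult ennreal_plus)
    then have "\<kappa> * c * j \<le> \<kappa> powr (1 - p) / p * g + \<kappa> * (1 - 1 / p) * (c * j)"
      using real j \<kappa> p c by (subst (asm) ennreal_le_iff) (auto intro!: add_nonneg_nonneg mult_nonneg_nonneg)
    then have "\<kappa> * c * j / p \<le> \<kappa> powr (1 - p) * g / p"
      using p by (simp add: field_simps)
    then have "\<kappa> * c * j \<le> \<kappa> powr (1 - p) * g"
      using p by (simp add: divide_le_cancel)
    then have "\<kappa> powr (p - 1) * (\<kappa> * c * j) \<le> \<kappa> powr (p - 1) * (\<kappa> powr (1 - p) * g)"
      by (intro mult_left_mono) auto
    also have "\<dots> = g" using \<kappa> by (simp add: mult.assoc[symmetric] flip: powr_add)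
    also have "\<kappa> powr (p - 1) * (\<kappa> * c * j) = \<kappa> powr p * c * j"
      using \<kappa> by (simp add: powr_diff)
    finally show ?thesis
      using j real \<kappa> c unfolding J_def[symmetric] G_def[symmetric] c_def[symmetric]
      by (simp add: ennreal_leI flip: ennreal_mult)
  qed (simp add: G_def)
qed

section \<open>Extended powers and removal of the truncation\<close>

lemma epowr_mono:
  assumes "x \<le> y" "0 \<le> a"
  shows "x epowr a \<le> y epowr a"
proof (cases "y = top")
  case False
  then have "x \<noteq> top" using assms by (auto simp: top_unique)
  then show ?thesis
    using assms False by (auto simp: epowr_def less_top intro!: ennreal_leI powr_mono2 enn2real_mono)
qed (simp add: epowr_def)

lemma ennreal_epowr: "0 \<le> x \<Longrightarrow> ennreal x epowr a = ennreal (x powr a)"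
  by (simp add: epowr_def)

lemma cmult_epowr_inverse:
  assumes "0 < c" "0 < a"
  shows "ennreal c * x epowr (1 / a) = (ennreal (c powr a) * x) epowr (1 / a)"
proof (cases x rule: ennreal_cases)
  case (real r)
  then show ?thesis
    using assms by (simp add: ennreal_epowr powr_mult powr_powr flip: ennreal_mult)
next
  case top
  then show ?thesis using assms by (simp add: epowr_def ennreal_mult_top)
qed

theorem theorem5p2:
  fixes H :: "real ^ 'n \<Rightarrow> real" and f :: "real ^ 'n \<Rightarrow> real"
    and d :: nat and p pstar :: real
  assumes "d = CARD('n)" and "d \<ge> 2"
    and "1 \<le> p" and "p < real d"
    and "pstar = p * real d / (real d - p)"
    and "is_norm H"
    and "test_function f"
  shows "(\<integral>\<^sup>+x. ennreal (H (gradient f x) powr p) \<partial>lebesgue) epowr (1 / p)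
    \<ge> ennreal ((real d - p) / p) * (emeasure lebesgue {x. dual_norm H x \<le> 1} epowr (1 / real d))
        * lorentz_norm pstar p f"
proof -
  define B where "B = {x. dual_norm H x \<le> 1}"
  define F where "F x = \<bar>f x\<bar>" for x
  define h where "h x = H (gradient f x)" for x
  define G where "G = (\<integral>\<^sup>+x. ennreal (h x powr p) \<partial>lborel)"
  define m where "m t = measure lborel {x. 0 < F x \<and> t \<le> F x}" for t
  define w where "w = root d (measure lebesgue B)"
  define L where "L = (\<integral>\<^sup>+t\<in>{0<..}. (emeasure lebesgue {x. \<bar>f x\<bar> > t} epowr (p / pstar)) * ennreal (t powr (p - 1)) \<partial>lborel)"
  have d: "d = DIM(real ^ 'n)" using assms(1) by simp
  have B: "convex B" "bounded B"
    unfolding B_def using dual_norm_unit_ball \<open>is_norm H\<close> by blast+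
  then have emB: "emeasure lebesgue B = ennreal (measure lebesgue B)"
    by (intro emeasure_eq_measure2 measurable_convex)
  have cont_f: "continuous_on UNIV f"
    using test_function_gradient(1)[OF \<open>test_function f\<close>]
    by (meson continuous_at_imp_continuous_on has_derivative_continuous)
  then have F: "continuous_on UNIV F" unfolding F_def by (intro continuous_intros)
  then have [measurable]: "F \<in> borel_measurable borel"
    by (rule borel_measurable_continuous_onI)
  have F_bd: "bounded {x. 0 < F x}"
    using test_function_support[OF \<open>test_function f\<close>] by (simp add: F_def)
  have h: "continuous_on UNIV h" "\<And>x. 0 \<le> h x"
  proof -
    show "continuous_on UNIV h" unfolding h_def
      using is_norm_continuous[OF \<open>is_norm H\<close>] test_function_gradient(2)[OF \<open>test_function f\<close>]
      by (rule continuous_on_compose2) simp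
    show "0 \<le> h x" for x using \<open>is_norm H\<close> by (simp add: h_def is_norm_def)
  qed
  have G: "(\<integral>\<^sup>+x. ennreal (H (gradient f x) powr p) \<partial>lebesgue) = G"
    by (simp add: G_def h_def nn_integral_completion)
  show ?thesis
  \<comment> \<open>With a ball of volume zero the right-hand side is 0, whatever the Lorentz norm,
    since 0 times \<infinity> is 0 here. From then on the positive volume required for the dilation
    estimate is available.\<close>
  proof (cases "measure lebesgue B = 0")
    case True
    then have "emeasure lebesgue {x. dual_norm H x \<le> 1} epowr (1 / real d) = 0"
      using emB by (simp add: B_def epowr_def)
    then show ?thesis by simp
  next
    case False
    then have B_pos: "0 < measure lebesgue B" by (simp add: zero_less_measure_iff)
    define \<kappa> where "\<kappa> = (real d - p) / p * w"
    have w: "0 < w" using B_pos assms(2) by (simp add: w_def)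
    have \<kappa>: "0 < \<kappa>" using w assms(3,4) by (simp add: \<kappa>_def)
    have descent: "\<exists>\<delta>>0. \<forall>e. 0 < e \<and> e < \<delta> \<longrightarrow>
      (\<forall>x y. 0 < F x \<longrightarrow> y \<in> B \<longrightarrow> F x - e * (h x + \<eta>) \<le> F (x + e *\<^sub>R y))" if "0 < \<eta>" for \<eta>
      using uniform_descent[OF \<open>is_norm H\<close> \<open>test_function f\<close> that] by (simp add: F_def h_def B_def)
    let ?g = "\<lambda>t. ennreal (t powr (p - 1) * m t powr (1 - p / real d))"
    have trunc: "ennreal (\<kappa> powr p * pstar) * (\<integral>\<^sup>+t\<in>{0<..<T}. ?g t \<partial>lborel) \<le> G"
      if "0 < T" "0 < m T" for T
      unfolding G_def \<kappa>_def w_def assms(5) m_def d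
      by (rule lorentz_sobolev_truncated[OF _ _ _ F F_bd h B B_pos])
        (use assms(2-4) that descent in \<open>auto simp: d m_def\<close>)
    have bdd: "bdd_above (range F)"
    proof -
      have "compact (F ` closure {x. 0 < F x})"
        using F F_bd by (intro compact_continuous_image) (auto intro: continuous_on_subset)
      then have "bdd_above (F ` closure {x. 0 < F x})"
        by (intro bounded_imp_bdd_above compact_imp_bounded)
      then obtain b where b: "\<And>y. y \<in> F ` closure {x. 0 < F x} \<Longrightarrow> y \<le> b"
        by (metis bdd_above.E)
      have "F x \<le> max 0 b" for x
        using b[of "F x"] closure_subset[of "{x. 0 < F x}"] by (cases "0 < F x") (auto simp: le_max_iff_disj)
      then show ?thesis by (intro bdd_aboveI2)
    qed
    define S where "S = (SUP x. F x)"
    have F_S: "F x \<le> S" for x unfolding S_def using bdd by (rule cSUP_upper2) auto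
    have S0: "0 \<le> S" using F_S[of 0] by (simp add: F_def)
    \<comment> \<open>Levels increasing to the supremum \<open>S\<close> but staying below it. The
      denominator starts at 2, so that \<open>T 0\<close> is positive when \<open>S\<close>
      is.\<close>
    define T where "T k = S - S / real (Suc (Suc k))" for k
    have m_meas: "m \<in> borel_measurable borel"
      unfolding m_def by (intro borel_measurable_antimono measure_superlevel_antimono F F_bd)
    \<comment> \<open>Only an inequality, since \<open>L\<close> uses strict superlevel sets and
      \<open>m\<close> non-strict ones. From the level \<open>S\<close> on the integrand of
      \<open>L\<close> vanishes, and each level in between lies below some
      \<open>T k\<close>.\<close>
    have "L \<le> (\<integral>\<^sup>+t. (SUP k. ?g t * indicator {0<..<T k} t) \<partial>lborel)"
      unfolding L_def
    proof (rule nn_integral_mono)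
      fix t :: real
      show "emeasure lebesgue {x. \<bar>f x\<bar> > t} epowr (p / pstar) * ennreal (t powr (p - 1)) * indicator {0<..} t
        \<le> (SUP k. ?g t * indicator {0<..<T k} t)"
      proof (cases "0 < t \<and> t < S")
        case True
        have op: "open {x. t < F x}" using F by (intro open_Collect_less continuous_intros)
        have fin: "{x. 0 < F x \<and> t \<le> F x} \<in> fmeasurable lborel"
          using F_bd by (intro bounded_fmeasurable_lborel) (auto intro: bounded_subset)
        have "emeasure lebesgue {x. \<bar>f x\<bar> > t} = emeasure lborel {x. t < F x}"
          using op by (simp add: F_def)
        also have "\<dots> \<le> emeasure lborel {x. 0 < F x \<and> t \<le> F x}"
          using True fin by (intro emeasure_mono) (auto dest: fmeasurableD)
        also have "\<dots> = ennreal (m t)"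
          using fin unfolding m_def by (rule emeasure_eq_measure2)
        finally have "emeasure lebesgue {x. \<bar>f x\<bar> > t} epowr (p / pstar) \<le> ennreal (m t) epowr (p / pstar)"
          using assms(3-5) by (intro epowr_mono) auto
        also have exponent: "p / pstar = 1 - p / real d"
          using assms(3,4) unfolding assms(5) by (simp add: field_simps)
        also have "ennreal (m t) epowr (1 - p / real d) = ennreal (m t powr (1 - p / real d))"
          by (intro ennreal_epowr) (simp add: m_def)
        finally have "emeasure lebesgue {x. \<bar>f x\<bar> > t} epowr (p / pstar) * ennreal (t powr (p - 1)) \<le> ?g t"
          unfolding exponent by (simp add: ennreal_mult mult.commute mult_left_mono)
        moreover
        obtain k where "S / (S - t) < real k" using reals_Archimedean2 by blast
        then have "S / (S - t) < real (Suc (Suc k))" by simp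
        then have "t < T k" using True by (simp add: T_def field_simps)
        then have "?g t \<le> (SUP k. ?g t * indicator {0<..<T k} t)"
          using True by (intro SUP_upper2[of k]) auto
        ultimately show ?thesis using True by (auto intro: order_trans)
      next
        case False
        have "{x. \<bar>f x\<bar> > t} = {}" if "0 < t"
        proof -
          have "\<not> t < F x" for x using False that F_S[of x] by linarith
          then show ?thesis by (simp add: F_def)
        qed
        then show ?thesis by (cases "0 < t") (auto simp: epowr_def)
      qed
    qed
    also have "\<dots> = (SUP k. \<integral>\<^sup>+t. ?g t * indicator {0<..<T k} t \<partial>lborel)"
    proof (rule nn_integral_monotone_convergence_SUP)
      show "incseq (\<lambda>k t. ?g t * indicator {0<..<T k} t)"
      proof (intro incseq_SucI le_funI)
        fix k t
        have "T k \<le> T (Suc k)"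
          unfolding T_def using S0 by (intro diff_left_mono divide_left_mono) auto
        then show "?g t * indicator {0<..<T k} t \<le> ?g t * indicator {0<..<T (Suc k)} t"
          by (intro mult_left_mono) (auto simp: indicator_def)
      qed
    qed (use m_meas in measurable)
    finally have "ennreal (\<kappa> powr p * pstar) * L
      \<le> ennreal (\<kappa> powr p * pstar) * (SUP k. \<integral>\<^sup>+t\<in>{0<..<T k}. ?g t \<partial>lborel)"
      by (intro mult_left_mono) auto
    also have "\<dots> = (SUP k. ennreal (\<kappa> powr p * pstar) * (\<integral>\<^sup>+t\<in>{0<..<T k}. ?g t \<partial>lborel))"
      by (rule SUP_mult_left_ennreal)
    also have "\<dots> \<le> G"
    proof (rule SUP_least)
      fix k
      show "ennreal (\<kappa> powr p * pstar) * (\<integral>\<^sup>+t\<in>{0<..<T k}. ?g t \<partial>lborel) \<le> G"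
      proof (cases "S = 0")
        case True
        then show ?thesis by (simp add: T_def)
      next
        case False
        then have T: "0 < T k" "T k < S"
          using S0 by (auto simp: T_def field_simps intro!: add_pos_nonneg)
        then obtain x where "T k < F x"
          unfolding S_def using bdd by (subst (asm) less_cSUP_iff) auto
        \<comment> \<open>A level below the supremum is exceeded somewhere, and the strict
          superlevel set is open, hence of positive volume. This yields the condition
          \<open>0 < m (T k)\<close> of the truncated inequality.\<close>
        then have "0 < measure lborel {x. T k < F x}"
          using F F_bd T by (intro open_measure_lborel_pos open_Collect_less continuous_intros)
            (auto intro: bounded_subset)
        also have "\<dots> \<le> m (T k)"
          unfolding m_def using T F_bd
          by (intro measure_mono_fmeasurable bounded_fmeasurable_lborel) (auto intro: bounded_subset)
        finally show ?thesis using trunc T by blast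
      qed
    qed
    finally have main: "ennreal (\<kappa> powr p) * (ennreal pstar * L) \<le> G"
      by (simp only: ennreal_mult' powr_ge_zero mult.assoc)
    have "emeasure lebesgue {x. dual_norm H x \<le> 1} epowr (1 / real d) = ennreal w"
      using emB B_pos assms(2)
      by (simp add: B_def[symmetric] ennreal_epowr w_def root_powr_inverse)
    moreover have "ennreal ((real d - p) / p) * ennreal w = ennreal \<kappa>"
      using assms(3,4) w unfolding \<kappa>_def by (intro ennreal_mult[symmetric]) auto
    ultimately have "ennreal ((real d - p) / p) * (emeasure lebesgue {x. dual_norm H x \<le> 1} epowr (1 / real d))
        * lorentz_norm pstar p f = ennreal \<kappa> * (ennreal pstar * L) epowr (1 / p)"
      by (simp add: lorentz_norm_def L_def)
    also have "\<dots> = (ennreal (\<kappa> powr p) * (ennreal pstar * L)) epowr (1 / p)"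
      using \<kappa> assms(3) by (intro cmult_epowr_inverse) auto
    also have "\<dots> \<le> G epowr (1 / p)"
      using main assms(3) by (intro epowr_mono) auto
    finally show ?thesis unfolding G .
  qed
qed

end
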